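(* Let $\mathcal H=L^2(0,T;\mathbb R^m)$ with inner product $\langle\cdot,\cdot\rangle$. Under the standing definiteness and boundedness hypotheses on the LQ data in the context, eliminating the state through the affine map $u\mapsto x_u$ reduces the LQ isoperimetric problem (minimize $J_{\rm LQ}(u)$ subject to $\int_0^Tu^\top D(t)u\,dt=\beta$) to $$\min_{u\in\mathcal H}\ f(u):=\tfrac12\langle u,\mathcal Ru\rangle+\langle\rho_0,u\rangle+\gamma_0\quad\text{subject to}\quad\mathcal C(u):=\langle u,\mathcal Du\rangle=\beta .$$ That is, there exist a bounded self-adjoint operator $\mathcal R=\mathcal R^*$ on $\mathcal H$ (the reduced-cost operator), $\rho_0\in\mathcal H$ and $\gamma_0\in\mathbb R$ such that $J_{\rm LQ}(u)=f(u)$ for all $u\in\mathcal H$, and, with $\mathcal D$ the operator of multiplication by $D(t)$, $\int_0^Tu^\top Du\,dt=\langle u,\mathcal Du\rangle$ and $\nabla\mathcal C(u)=2\mathcal Du$. The operators are bounded and satisfy $$\rho I\preceq\mathcal R\preceq\bar rI,\qquad dI\preceq\mathcal D\preceq\bar dI$$ for constants $0<\rho\le\bar r$ and $0<d\le\bar d$, where $\rho$ and $d$ are the lower bounds of $R(t)$ and $D(t)$; in particular both are coercive.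
   Context: LQ data. Fix $T>0$, $x_0\in\mathbb R^n$, and measurable bounded coefficients $A(t)\in\mathbb R^{n\times n}$, $B(t)\in\mathbb R^{n\times m}$, symmetric $Q(t)\succeq0$, symmetric $R(t)\succeq\rho I$, symmetric $D(t)\succeq dI$ for a.e. $t$, with constants $\rho,d>0$, and a symmetric matrix $M\succeq0$. For $u\in\mathcal H$, $x=x_u$ solves $\dot x=A(t)x+B(t)u$, $x(0)=x_0$, and $$J_{\rm LQ}(u)=\tfrac12x(T)^\top Mx(T)+\tfrac12\int_0^T[x^\top Q(t)x+u^\top R(t)u]\,dt.$$ *)

theory Defs
  imports "HOL-Analysis.Analysis"
begin

section \<open>The space \<open>L\<^sup>2(0,T;\<real>\<^sup>m)\<close>\<close>

text \<open>
  The horizon \<open>T\<close> is a value, so the Hilbert space cannot be a type. Its elements are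
  represented by square-integrable functions, identified when they agree almost everywhere
  (\<open>L2_eq\<close>); operators must respect this identification. The endpoints of \<open>{0..T}\<close> are
  Lebesgue-null.
\<close>

definition L2 :: "real \<Rightarrow> (real \<Rightarrow> 'a::euclidean_space) set" where
  "L2 T = {u. u \<in> borel_measurable (lebesgue_on {0..T}) \<and>
              integrable (lebesgue_on {0..T}) (\<lambda>t. (norm (u t))\<^sup>2)}"

definition L2_eq :: "real \<Rightarrow> (real \<Rightarrow> 'a::euclidean_space) \<Rightarrow> (real \<Rightarrow> 'a) \<Rightarrow> bool" where
  "L2_eq T u v \<longleftrightarrow> (AE t in lebesgue_on {0..T}. u t = v t)"

definition L2_inner :: "real \<Rightarrow> (real \<Rightarrow> 'a::euclidean_space) \<Rightarrow> (real \<Rightarrow> 'a) \<Rightarrow> real" where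
  "L2_inner T u v = (LINT t|lebesgue_on {0..T}. u t \<bullet> v t)"

definition L2_norm :: "real \<Rightarrow> (real \<Rightarrow> 'a::euclidean_space) \<Rightarrow> real" where
  "L2_norm T u = sqrt (L2_inner T u u)"

definition L2_bounded_operator ::
    "real \<Rightarrow> ((real \<Rightarrow> 'a::euclidean_space) \<Rightarrow> (real \<Rightarrow> 'a)) \<Rightarrow> bool" where
  "L2_bounded_operator T F \<longleftrightarrow>
     (\<forall>u\<in>L2 T. F u \<in> L2 T) \<and>
     (\<forall>u\<in>L2 T. \<forall>v\<in>L2 T. L2_eq T u v \<longrightarrow> L2_eq T (F u) (F v)) \<and>
     (\<forall>u\<in>L2 T. \<forall>v\<in>L2 T. L2_eq T (F (\<lambda>t. u t + v t)) (\<lambda>t. F u t + F v t)) \<and>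
     (\<forall>u\<in>L2 T. \<forall>c. L2_eq T (F (\<lambda>t. c *\<^sub>R u t)) (\<lambda>t. c *\<^sub>R F u t)) \<and>
     (\<exists>K. \<forall>u\<in>L2 T. L2_norm T (F u) \<le> K * L2_norm T u)"

definition L2_self_adjoint ::
    "real \<Rightarrow> ((real \<Rightarrow> 'a::euclidean_space) \<Rightarrow> (real \<Rightarrow> 'a)) \<Rightarrow> bool" where
  "L2_self_adjoint T F \<longleftrightarrow>
     (\<forall>u\<in>L2 T. \<forall>v\<in>L2 T. L2_inner T (F u) v = L2_inner T u (F v))"

definition L2_op_le ::
    "real \<Rightarrow> ((real \<Rightarrow> 'a::euclidean_space) \<Rightarrow> (real \<Rightarrow> 'a)) \<Rightarrow>
     ((real \<Rightarrow> 'a) \<Rightarrow> (real \<Rightarrow> 'a)) \<Rightarrow> bool" where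
  "L2_op_le T F G \<longleftrightarrow> (\<forall>u\<in>L2 T. L2_inner T u (F u) \<le> L2_inner T u (G u))"

definition scaled_id :: "real \<Rightarrow> (real \<Rightarrow> 'a::euclidean_space) \<Rightarrow> (real \<Rightarrow> 'a)" where
  "scaled_id c u = (\<lambda>t. c *\<^sub>R u t)"

definition L2_coercive ::
    "real \<Rightarrow> ((real \<Rightarrow> 'a::euclidean_space) \<Rightarrow> (real \<Rightarrow> 'a)) \<Rightarrow> bool" where
  "L2_coercive T F \<longleftrightarrow> (\<exists>c>0. \<forall>u\<in>L2 T. c * (L2_norm T u)\<^sup>2 \<le> L2_inner T u (F u))"

text \<open>Frechet differentiability at \<open>u\<close>, with derivative represented by \<open>g\<close>.\<close>

definition has_L2_gradient ::
    "real \<Rightarrow> ((real \<Rightarrow> 'a::euclidean_space) \<Rightarrow> real) \<Rightarrow> (real \<Rightarrow> 'a) \<Rightarrow> (real \<Rightarrow> 'a) \<Rightarrow> bool" where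
  "has_L2_gradient T \<phi> u g \<longleftrightarrow> g \<in> L2 T \<and>
     (\<forall>\<epsilon>>0. \<exists>\<delta>>0. \<forall>h\<in>L2 T. L2_norm T h < \<delta> \<longrightarrow>
        \<bar>\<phi> (\<lambda>t. u t + h t) - \<phi> u - L2_inner T g h\<bar> \<le> \<epsilon> * L2_norm T h)"

definition mult_op :: "(real \<Rightarrow> real^'m^'m) \<Rightarrow> (real \<Rightarrow> real^'m) \<Rightarrow> (real \<Rightarrow> real^'m)" where
  "mult_op D u = (\<lambda>t. D t *v u t)"

section \<open>LQ data\<close>

definition L_infinity :: "real \<Rightarrow> (real \<Rightarrow> 'a::euclidean_space) \<Rightarrow> bool" where
  "L_infinity T F \<longleftrightarrow> F \<in> borel_measurable (lebesgue_on {0..T}) \<and>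
     (\<exists>K. AE t in lebesgue_on {0..T}. norm (F t) \<le> K)"

text \<open>The Loewner order; the order of the type \<open>real^'n^'n\<close> is the entrywise one.\<close>

definition loewner_le :: "real^'n^'n \<Rightarrow> real^'n^'n \<Rightarrow> bool" where
  "loewner_le S S' \<longleftrightarrow> (\<forall>v. v \<bullet> (S *v v) \<le> v \<bullet> (S' *v v))"

text \<open>
  Absolute continuity on \<open>[a,b]\<close>: the sum runs over the intervals of a finite family of
  non-overlapping compact subintervals, and \<open>Inf k\<close>, \<open>Sup k\<close> are the endpoints of \<open>k\<close>.
\<close>

definition absolutely_continuous_on ::
    "real \<Rightarrow> real \<Rightarrow> (real \<Rightarrow> 'a::euclidean_space) \<Rightarrow> bool" where
  "absolutely_continuous_on a b x \<longleftrightarrow>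
     (\<forall>\<epsilon>>0. \<exists>\<delta>>0. \<forall>d S. d division_of S \<and> S \<subseteq> {a..b} \<and> (\<Sum>k\<in>d. Sup k - Inf k) < \<delta> \<longrightarrow>
        (\<Sum>k\<in>d. norm (x (Sup k) - x (Inf k))) < \<epsilon>)"

text \<open>Caratheodory solutions of \<open>x' = A x + B u\<close>, \<open>x(0) = x\<^sub>0\<close> on \<open>[0,T]\<close>.\<close>

definition lq_trajectory ::
    "real \<Rightarrow> (real \<Rightarrow> real^'n^'n) \<Rightarrow> (real \<Rightarrow> real^'m^'n) \<Rightarrow> real^'n \<Rightarrow>
     (real \<Rightarrow> real^'m) \<Rightarrow> (real \<Rightarrow> real^'n) \<Rightarrow> bool" where
  "lq_trajectory T A B x0 u x \<longleftrightarrow>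
     absolutely_continuous_on 0 T x \<and> x 0 = x0 \<and>
     (AE t in lebesgue_on {0..T}.
        (x has_vector_derivative (A t *v x t + B t *v u t)) (at t within {0..T}))"

text \<open>
  The state \<open>x\<^sub>u\<close>. Solutions are unique only as functions on \<open>[0,T]\<close>, hence the choice
  operator instead of a definite description; only values on \<open>[0,T]\<close> are ever used.
\<close>

definition lq_state ::
    "real \<Rightarrow> (real \<Rightarrow> real^'n^'n) \<Rightarrow> (real \<Rightarrow> real^'m^'n) \<Rightarrow> real^'n \<Rightarrow>
     (real \<Rightarrow> real^'m) \<Rightarrow> (real \<Rightarrow> real^'n)" where
  "lq_state T A B x0 u = (SOME x. lq_trajectory T A B x0 u x)"

definition lq_cost ::
    "real \<Rightarrow> (real \<Rightarrow> real^'n^'n) \<Rightarrow> (real \<Rightarrow> real^'m^'n) \<Rightarrow> real^'n \<Rightarrow>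
     (real \<Rightarrow> real^'n^'n) \<Rightarrow> (real \<Rightarrow> real^'m^'m) \<Rightarrow> real^'n^'n \<Rightarrow>
     (real \<Rightarrow> real^'m) \<Rightarrow> real" where
  "lq_cost T A B x0 Q R M u =
     (let x = lq_state T A B x0 u in
        1/2 * (x T \<bullet> (M *v x T)) +
        1/2 * (LINT t|lebesgue_on {0..T}. x t \<bullet> (Q t *v x t) + u t \<bullet> (R t *v u t)))"

end

theory Submission
  imports Defs
begin

text \<open>
  Write \<open>x\<^sub>u = z + y\<^sub>u\<close> on \<open>[0,T]\<close>, where \<open>z\<close> is the state for \<open>u = 0\<close> and \<open>y\<^sub>u\<close> solves the equation
  with zero initial value, hence is linear in \<open>u\<close> and bounded by a multiple of \<open>L2_norm T u\<close>.
  Expanding the cost leaves a symmetric quadratic form and a linear form in \<open>y\<^sub>u\<close>. For a source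
  \<open>w\<close> (\<open>y\<^sub>u\<close> or \<open>z\<close>), the adjoint equation \<open>- p' = A\<^sup>T p + Q w\<close>, \<open>p(T) = M w(T)\<close>, turns
  \<open>w(T)\<^sup>T M y\<^sub>v(T) + \<integral> w\<^sup>T Q y\<^sub>v\<close> into the inner product of \<open>B\<^sup>T p\<close> with \<open>v\<close>; so the reduced operator is
  \<open>u \<mapsto> R u + B\<^sup>T p\<close>. The differential equations are solved as Volterra equations by a contraction in
  an exponentially weighted sup norm; the passage between Caratheodory solutions and integral
  equations is the fundamental theorem of calculus for absolutely continuous functions, proved with
  gauge integrals: tags in the exceptional null set only see subintervals of small total length.
\<close>

section \<open>Absolutely continuous functions\<close>

text \<open>The coefficients are merely bounded and measurable, so a state has its derivative only
  almost everywhere, and every argument about the equations has to pass through integrals. The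
  reduced operator is the Hessian of the cost: pairing \<open>\<R> u\<close> with v gives the
  integral of v^T R u, plus y_u(T)^T M y_v(T), plus the integral of y_u^T Q y_v. This form is
  visibly symmetric, and on the diagonal its last two terms are nonnegative, so the lower bound
  \<rho> of R(t) passes to \<open>\<R>\<close> unchanged. The difficulty is to exhibit elements of
  L2 that realise these pairings, with a bound on their norms. The bound follows the chain from u in
  L2 to B u in L1, y_u in the sup norm, the adjoint state p in the sup norm, and B^T p in L2; each
  arrow costs one constant. A representative is determined only up to null sets and is picked by
  choice, so linearity of \<open>\<R>\<close> cannot be read off its definition. It is recovered
  from the pairings, by moving the operator to the test function.\<close>

lemma AE_lebesgue_on_iff_negligible:
  assumes "S \<in> sets lebesgue"
  shows "(AE x in lebesgue_on S. P x) \<longleftrightarrow> negligible {x\<in>S. \<not> P x}"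
proof -
  have "(AE x in lebesgue_on S. P x) \<longleftrightarrow> (AE x in lebesgue. x \<in> S \<longrightarrow> P x)"
    using assms by (simp add: AE_restrict_space_iff)
  also have "\<dots> \<longleftrightarrow> negligible {x\<in>S. \<not> P x}"
    unfolding eventually_ae_filter_negligible
    by (metis (mono_tags, lifting) Collect_cong negligible_subset not_imp order_refl)
  finally show ?thesis .
qed

lemma division_of_singleton_Icc: "s \<le> t \<Longrightarrow> {{s..t::real}} division_of {s..t}"
  by (metis atLeastatMost_empty_iff2 box_real(2) division_of_self not_le)

lemma absolutely_continuous_on_imp_continuous_on:
  assumes "absolutely_continuous_on a b x"
  shows "continuous_on {a..b} x"
  unfolding continuous_on_iff
proof (intro ballI allI impI)
  fix s e :: real
  assume s: "s \<in> {a..b}" and "0 < e"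
  then obtain \<delta> where "\<delta> > 0"
    and \<delta>: "\<And>d S. d division_of S \<Longrightarrow> S \<subseteq> {a..b} \<Longrightarrow> (\<Sum>k\<in>d. Sup k - Inf k) < \<delta> \<Longrightarrow>
        (\<Sum>k\<in>d. norm (x (Sup k) - x (Inf k))) < e"
    using assms unfolding absolutely_continuous_on_def by meson
  have *: "norm (x v - x u) < e" if "u \<in> {a..b}" "v \<in> {a..b}" "u \<le> v" "v - u < \<delta>" for u v
    using \<delta>[OF division_of_singleton_Icc[OF \<open>u \<le> v\<close>]] that by auto
  have "dist (x t) (x s) < e" if t: "t \<in> {a..b}" "dist t s < \<delta>" for t
    using *[of s t] *[of t s] s t unfolding dist_norm
    by (cases "s \<le> t") (auto simp: norm_minus_commute)
  with \<open>\<delta> > 0\<close> show "\<exists>d>0. \<forall>t\<in>{a..b}. dist t s < d \<longrightarrow> dist (x t) (x s) < e"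
    by blast
qed

lemma division_of_IccE:
  assumes "d division_of S" "S \<subseteq> {a..b::real}" "k \<in> d"
  obtains u v where "k = {u..v}" "u \<le> v" "a \<le> u" "v \<le> b" "Sup k = v" "Inf k = u"
proof -
  from assms obtain u v where k: "k = {u..v}" "k \<noteq> {}" "k \<subseteq> S"
    by (metis box_real(2) division_ofD(2-4))
  then have "{u..v} \<subseteq> {a..b}" using assms(2) by blast
  with k show thesis by (intro that[of u v]) auto
qed

text \<open>This is the one epsilon-delta argument behind the closure properties that follow:
  increments of linear combinations and of inner products are all controlled by the increments of
  two absolutely continuous functions.\<close>

lemma absolutely_continuous_on_dominated:
  assumes x: "absolutely_continuous_on a b x" and y: "absolutely_continuous_on a b y"
    and C: "C \<ge> 0" "\<And>s t. s \<in> {a..b} \<Longrightarrow> t \<in> {a..b} \<Longrightarrow>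
      norm (z t - z s) \<le> C * (norm (x t - x s) + norm (y t - y s))"
  shows "absolutely_continuous_on a b z"
  unfolding absolutely_continuous_on_def
proof (intro allI impI)
  fix \<epsilon> :: real assume "\<epsilon> > 0"
  \<comment> \<open>The two sums together contribute C * 2 * \<eta> = \<epsilon> * C / (C + 1),
    which stays strictly below \<epsilon>; the summand 1 also covers C = 0.\<close>
  define \<eta> where "\<eta> = \<epsilon> / (2 * (C + 1))"
  have "\<eta> > 0" using \<open>\<epsilon> > 0\<close> C by (simp add: \<eta>_def)
  obtain \<delta>1 where "\<delta>1 > 0"
    and \<delta>1: "\<And>d S. d division_of S \<Longrightarrow> S \<subseteq> {a..b} \<Longrightarrow> (\<Sum>k\<in>d. Sup k - Inf k) < \<delta>1 \<Longrightarrow>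
        (\<Sum>k\<in>d. norm (x (Sup k) - x (Inf k))) < \<eta>"
    using x \<open>\<eta> > 0\<close> unfolding absolutely_continuous_on_def by meson
  obtain \<delta>2 where "\<delta>2 > 0"
    and \<delta>2: "\<And>d S. d division_of S \<Longrightarrow> S \<subseteq> {a..b} \<Longrightarrow> (\<Sum>k\<in>d. Sup k - Inf k) < \<delta>2 \<Longrightarrow>
        (\<Sum>k\<in>d. norm (y (Sup k) - y (Inf k))) < \<eta>"
    using y \<open>\<eta> > 0\<close> unfolding absolutely_continuous_on_def by meson
  show "\<exists>\<delta>>0. \<forall>d S. d division_of S \<and> S \<subseteq> {a..b} \<and> (\<Sum>k\<in>d. Sup k - Inf k) < \<delta> \<longrightarrow>
      (\<Sum>k\<in>d. norm (z (Sup k) - z (Inf k))) < \<epsilon>"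
  proof (intro exI[of _ "min \<delta>1 \<delta>2"] conjI allI impI, goal_cases)
    case 1
    then show ?case using \<open>\<delta>1 > 0\<close> \<open>\<delta>2 > 0\<close> by simp
  next
    case (2 d S)
    then have d: "d division_of S" "S \<subseteq> {a..b}" "(\<Sum>k\<in>d. Sup k - Inf k) < min \<delta>1 \<delta>2" by auto
    have "(\<Sum>k\<in>d. norm (z (Sup k) - z (Inf k)))
        \<le> (\<Sum>k\<in>d. C * (norm (x (Sup k) - x (Inf k)) + norm (y (Sup k) - y (Inf k))))"
    proof (rule sum_mono)
      fix k assume "k \<in> d"
      with d obtain u v where "Sup k = v" "Inf k = u" "u \<in> {a..b}" "v \<in> {a..b}"
        by (elim division_of_IccE) auto
      then show "norm (z (Sup k) - z (Inf k))
          \<le> C * (norm (x (Sup k) - x (Inf k)) + norm (y (Sup k) - y (Inf k)))"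
        using C(2) by simp
    qed
    also have "\<dots> = C * ((\<Sum>k\<in>d. norm (x (Sup k) - x (Inf k))) + (\<Sum>k\<in>d. norm (y (Sup k) - y (Inf k))))"
      by (simp add: distrib_left sum.distrib flip: sum_distrib_left)
    also have "\<dots> \<le> C * (\<eta> + \<eta>)"
      using \<delta>1[OF d(1,2)] \<delta>2[OF d(1,2)] d(3) C(1) by (intro mult_left_mono) auto
    also have "\<dots> = C * (\<epsilon> / (C + 1))"
      using C(1) by (simp add: \<eta>_def divide_simps)
    also have "\<dots> < \<epsilon>"
      using \<open>\<epsilon> > 0\<close> C(1) by (simp add: divide_less_eq algebra_simps)
    finally show ?case .
  qed
qed

lemma absolutely_continuous_on_cong:
  assumes "absolutely_continuous_on a b x" "\<And>t. t \<in> {a..b} \<Longrightarrow> x t = y t"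
  shows "absolutely_continuous_on a b y"
  by (rule absolutely_continuous_on_dominated[OF assms(1,1), where C = 1]) (use assms(2) in auto)

lemma absolutely_continuous_on_lincomb:
  assumes "absolutely_continuous_on a b x" "absolutely_continuous_on a b y"
  shows "absolutely_continuous_on a b (\<lambda>t. \<alpha> *\<^sub>R x t + \<beta> *\<^sub>R y t)"
proof (rule absolutely_continuous_on_dominated[OF assms, where C = "max \<bar>\<alpha>\<bar> \<bar>\<beta>\<bar>"])
  fix s t
  have "norm (\<alpha> *\<^sub>R x t + \<beta> *\<^sub>R y t - (\<alpha> *\<^sub>R x s + \<beta> *\<^sub>R y s))
      = norm (\<alpha> *\<^sub>R (x t - x s) + \<beta> *\<^sub>R (y t - y s))"
    by (simp add: algebra_simps)
  also have "\<dots> \<le> \<bar>\<alpha>\<bar> * norm (x t - x s) + \<bar>\<beta>\<bar> * norm (y t - y s)"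
    by (metis norm_scaleR norm_triangle_ineq)
  also have "\<dots> \<le> max \<bar>\<alpha>\<bar> \<bar>\<beta>\<bar> * norm (x t - x s) + max \<bar>\<alpha>\<bar> \<bar>\<beta>\<bar> * norm (y t - y s)"
    by (intro add_mono mult_right_mono) auto
  finally show "norm (\<alpha> *\<^sub>R x t + \<beta> *\<^sub>R y t - (\<alpha> *\<^sub>R x s + \<beta> *\<^sub>R y s))
      \<le> max \<bar>\<alpha>\<bar> \<bar>\<beta>\<bar> * (norm (x t - x s) + norm (y t - y s))"
    by (simp add: distrib_left)
qed auto

lemma absolutely_continuous_on_inner:
  assumes x: "absolutely_continuous_on a b x" and y: "absolutely_continuous_on a b y"
  shows "absolutely_continuous_on a b (\<lambda>t. x t \<bullet> y t)"
proof -
  have "bounded (x ` {a..b})" "bounded (y ` {a..b})"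
    using x y by (auto intro!: compact_imp_bounded compact_continuous_image
        absolutely_continuous_on_imp_continuous_on)
  then obtain K L where K: "\<And>t. t \<in> {a..b} \<Longrightarrow> norm (x t) \<le> K" "K > 0"
    and L: "\<And>t. t \<in> {a..b} \<Longrightarrow> norm (y t) \<le> L" "L > 0"
    by (metis bounded_pos imageI)
  show ?thesis
  proof (rule absolutely_continuous_on_dominated[OF x y, where C = "K + L"])
    fix s t assume st: "s \<in> {a..b}" "t \<in> {a..b}"
    have "norm (x t \<bullet> y t - x s \<bullet> y s) = norm ((x t - x s) \<bullet> y t + x s \<bullet> (y t - y s))"
      by (simp add: algebra_simps)
    also have "\<dots> \<le> norm (x t - x s) * norm (y t) + norm (x s) * norm (y t - y s)"
      by (intro norm_triangle_mono) (auto simp: Cauchy_Schwarz_ineq2)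
    also have "\<dots> \<le> norm (x t - x s) * (K + L) + (K + L) * norm (y t - y s)"
      using K(1)[OF st(1)] L(1)[OF st(2)] K(2) L(2) by (intro add_mono mult_mono) auto
    finally show "norm (x t \<bullet> y t - x s \<bullet> y s) \<le> (K + L) * (norm (x t - x s) + norm (y t - y s))"
      by (simp add: algebra_simps)
  qed (use K L in auto)
qed

text \<open>Truncation: the norm of f is at most n + \<open>g n\<close>, where \<open>g n\<close> is
  its excess over n. The integral of the excess tends to 0 by dominated convergence, so n can be
  fixed with excess below \<epsilon>/2 on the whole interval. On a division of small total length
  the bounded part then contributes at most n times that length.\<close>

lemma absolutely_continuous_on_integral:
  fixes f :: "real \<Rightarrow> 'a::euclidean_space"
  assumes f: "integrable (lebesgue_on {a..b}) f"
  shows "absolutely_continuous_on a b (\<lambda>t. c + integral {a..t} f)"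
  unfolding absolutely_continuous_on_def
proof (intro allI impI)
  fix \<epsilon> :: real assume "\<epsilon> > 0"
  define g where "g = (\<lambda>n::nat. \<lambda>t. max 0 (norm (f t) - real n))"
  have [measurable]: "f \<in> borel_measurable (lebesgue_on {a..b})" using f by simp
  have gI: "integrable (lebesgue_on {a..b}) (g n)" for n
    by (rule Bochner_Integration.integrable_bound[OF f]) (auto simp: g_def)
  have "(\<lambda>n. \<integral>t. g n t \<partial>lebesgue_on {a..b}) \<longlonglongrightarrow> (\<integral>t. 0 \<partial>lebesgue_on {a..b})"
  proof (rule integral_dominated_convergence[where w = "\<lambda>t. norm (f t)"])
    show "AE t in lebesgue_on {a..b}. (\<lambda>n. g n t) \<longlonglongrightarrow> 0"
    proof (rule AE_I2, rule tendsto_eventually)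
      fix t
      obtain N :: nat where "norm (f t) \<le> real N" using real_arch_simple by blast
      then show "\<forall>\<^sub>F n in sequentially. g n t = 0"
        unfolding eventually_sequentially g_def by (intro exI[of _ N]) auto
    qed
  qed (use f in \<open>auto simp: g_def\<close>)
  then have "(\<lambda>n. \<integral>t. g n t \<partial>lebesgue_on {a..b}) \<longlonglongrightarrow> 0" by simp
  then have "\<forall>\<^sub>F n in sequentially. (\<integral>t. g n t \<partial>lebesgue_on {a..b}) < \<epsilon> / 2"
    using \<open>\<epsilon> > 0\<close> by (intro order_tendstoD(2)[of _ 0]) auto
  then obtain n where n: "(\<integral>t. g n t \<partial>lebesgue_on {a..b}) < \<epsilon> / 2"
    by (auto simp: eventually_sequentially)
  have gn: "g n integrable_on {a..b}" and gn2: "integral {a..b} (g n) < \<epsilon> / 2"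
    using n by (auto simp: gI integrable_on_lebesgue_on simp flip: lebesgue_integral_eq_integral)
  have fI: "f integrable_on {a..b}"
    using f by (simp add: integrable_on_lebesgue_on)
  define \<delta> where "\<delta> = \<epsilon> / (2 * (real n + 1))"
  have "\<delta> > 0" using \<open>\<epsilon> > 0\<close> by (simp add: \<delta>_def)
  show "\<exists>\<delta>>0. \<forall>d S. d division_of S \<and> S \<subseteq> {a..b} \<and> (\<Sum>k\<in>d. Sup k - Inf k) < \<delta> \<longrightarrow>
      (\<Sum>k\<in>d. norm (c + integral {a..Sup k} f - (c + integral {a..Inf k} f))) < \<epsilon>"
  proof (intro exI[of _ \<delta>] conjI allI impI \<open>\<delta> > 0\<close>, elim conjE)
    fix d S assume d: "d division_of S" "S \<subseteq> {a..b}" "(\<Sum>k\<in>d. Sup k - Inf k) < \<delta>"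
    have "norm (c + integral {a..Sup k} f - (c + integral {a..Inf k} f))
        \<le> real n * (Sup k - Inf k) + integral k (g n)" if "k \<in> d" for k
    proof -
      from d that obtain u v where k: "k = {u..v}"
        and uv: "u \<le> v" "a \<le> u" "v \<le> b" "Sup k = v" "Inf k = u"
        by (elim division_of_IccE)
      then have sub: "{u..v} \<subseteq> {a..b}" "{a..v} \<subseteq> {a..b}" by auto
      have fv: "f integrable_on {a..v}" "f integrable_on {u..v}" and gv: "g n integrable_on {u..v}"
        using fI gn sub integrable_subinterval_real by blast+
      have "integral {a..v} f = integral {a..u} f + integral {u..v} f"
        using fv uv Henstock_Kurzweil_Integration.integral_combine[of a u v f] by simp
      then have "norm (c + integral {a..Sup k} f - (c + integral {a..Inf k} f)) = norm (integral {u..v} f)"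
        using uv by simp
      also have "\<dots> \<le> integral {u..v} (\<lambda>t. real n + g n t)"
        using gv fv by (intro integral_norm_bound_integral) (auto simp: g_def intro!: integrable_add)
      also have "\<dots> = real n * (v - u) + integral {u..v} (g n)"
        using gv uv by (subst integral_add) auto
      finally show ?thesis using k uv by simp
    qed
    then have "(\<Sum>k\<in>d. norm (c + integral {a..Sup k} f - (c + integral {a..Inf k} f)))
        \<le> (\<Sum>k\<in>d. real n * (Sup k - Inf k) + integral k (g n))"
      by (rule sum_mono)
    also have "\<dots> = real n * (\<Sum>k\<in>d. Sup k - Inf k) + integral S (g n)"
      using integral_unique[OF has_integral_combine_division_topdown[OF gn d(1,2)]]
      by (simp add: sum.distrib sum_distrib_left)
    also have "integral S (g n) \<le> integral {a..b} (g n)"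
      using has_integral_combine_division_topdown[OF gn d(1,2)] gn d(2)
      by (intro integral_subset_le) (auto simp: g_def integrable_on_def)
    also have "real n * (\<Sum>k\<in>d. Sup k - Inf k) + integral {a..b} (g n) < real n * \<delta> + \<epsilon> / 2"
      using gn2 d(3) by (intro add_le_less_mono mult_left_mono) auto
    also have "\<dots> \<le> \<epsilon>"
      using \<open>\<epsilon> > 0\<close> by (simp add: \<delta>_def field_simps)
    finally show "(\<Sum>k\<in>d. norm (c + integral {a..Sup k} f - (c + integral {a..Inf k} f))) < \<epsilon>"
      by simp
  qed
qed


text \<open>Integrability of \<open>f'\<close> is part of the conclusion. At tags where f is
  differentiable, the increment of f differs from the Riemann term by at most \<eta> times the
  length of the interval. At the remaining tags the Riemann term is made 0, so only increments of f
  survive, and absolute continuity makes their sum small.\<close>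

theorem fundamental_theorem_of_calculus_absolutely_continuous:
  fixes f :: "real \<Rightarrow> 'a::euclidean_space"
  assumes ab: "a \<le> b" and f: "absolutely_continuous_on a b f"
    and deriv: "AE t in lebesgue_on {a..b}. (f has_vector_derivative f' t) (at t within {a..b})"
  shows "(f' has_integral (f b - f a)) {a..b}"
proof -
  define N where "N = {t\<in>{a..b}. \<not> (f has_vector_derivative f' t) (at t within {a..b})}"
  have N: "negligible N"
    using deriv by (simp add: N_def AE_lebesgue_on_iff_negligible)
  \<comment> \<open>On N the function \<open>f'\<close> is arbitrary; setting it to 0 there removes
    the Riemann terms with exceptional tags, and the final spike argument returns to
    \<open>f'\<close>.\<close>
  define g where "g = (\<lambda>t. if t \<in> N then 0 else f' t)"
  have "(g has_integral (f b - f a)) {a..b}"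
    unfolding has_integral_real
  proof (intro allI impI)
    fix e :: real assume "e > 0"
    \<comment> \<open>The regular tags contribute at most \<eta> * (b - a), which is strictly below
      e/2 even when a = b.\<close>
    define \<eta> where "\<eta> = e / (2 * (b - a + 1))"
    have "\<eta> > 0" using \<open>e > 0\<close> ab by (simp add: \<eta>_def)
    have "\<forall>x. \<exists>r>0. x \<in> {a..b} - N \<longrightarrow>
        (\<forall>y\<in>{a..b}. norm (y - x) < r \<longrightarrow> norm (f y - f x - (y - x) *\<^sub>R f' x) \<le> \<eta> * norm (y - x))"
    proof
      fix x
      show "\<exists>r>0. x \<in> {a..b} - N \<longrightarrow>
        (\<forall>y\<in>{a..b}. norm (y - x) < r \<longrightarrow> norm (f y - f x - (y - x) *\<^sub>R f' x) \<le> \<eta> * norm (y - x))"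
      proof (cases "x \<in> {a..b} - N")
        case True
        then show ?thesis
          using \<open>\<eta> > 0\<close> unfolding N_def has_vector_derivative_def has_derivative_within_alt by blast
      qed (auto intro: exI[of _ 1])
    qed
    then obtain r where r: "\<And>x. r x > 0"
      "\<And>x y. x \<in> {a..b} - N \<Longrightarrow> y \<in> {a..b} \<Longrightarrow> norm (y - x) < r x \<Longrightarrow>
        norm (f y - f x - (y - x) *\<^sub>R f' x) \<le> \<eta> * norm (y - x)"
      by metis
    obtain \<delta> where "\<delta> > 0"
      and \<delta>: "\<And>d S. d division_of S \<Longrightarrow> S \<subseteq> {a..b} \<Longrightarrow> (\<Sum>k\<in>d. Sup k - Inf k) < \<delta> \<Longrightarrow>
        (\<Sum>k\<in>d. norm (f (Sup k) - f (Inf k))) < e / 2"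
      using f \<open>e > 0\<close> unfolding absolutely_continuous_on_def by (metis half_gt_zero)
    have N0: "N \<in> null_sets lebesgue" using N by (simp add: negligible_iff_null_sets)
    obtain U where U: "open U" "N \<subseteq> U" "U - N \<in> lmeasurable" "emeasure lebesgue (U - N) < ennreal \<delta>"
      using sets_lebesgue_outer_open[of N \<delta>] N0 \<open>\<delta> > 0\<close> by blast
    have Um: "U \<in> lmeasurable"
      using U(2,3) N by (metis Diff_partition fmeasurable.Un negligible_imp_measurable)
    have "emeasure lebesgue U < ennreal \<delta>"
      using U(4) emeasure_Diff_null_set[OF N0, of U] U(1) by (simp add: lborelD)
    then have mU: "measure lebesgue U < \<delta>"
      using Um \<open>\<delta> > 0\<close> by (simp add: emeasure_eq_measure2 ennreal_less_iff)
    \<comment> \<open>An exceptional tag is given the whole open set U, so all intervals tagged in N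
      lie in U and their total length is below \<delta>, however many of them there are.\<close>
    define \<gamma> where "\<gamma> = (\<lambda>x. if x \<in> N then U else ball x (r x))"
    have gauge: "gauge \<gamma>"
      using U r(1) by (auto simp: \<gamma>_def gauge_def)
    have small: "norm ((\<Sum>(x,k)\<in>p. measure lborel k *\<^sub>R g x) - (f b - f a)) < e"
      if p: "p tagged_division_of {a..b}" and fine: "\<gamma> fine p" for p
    proof -
      define F where "F = (\<lambda>(x,k). measure lborel k *\<^sub>R g x - (f (Sup k) - f (Inf k)))"
      define p1 where "p1 = {(x,k)\<in>p. x \<notin> N}"
      define p2 where "p2 = {(x,k)\<in>p. x \<in> N}"
      have fin: "finite p" and pp: "p = p1 \<union> p2" "p1 \<inter> p2 = {}" "p1 \<subseteq> p" "p2 \<subseteq> p"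
        using p by (auto simp: p1_def p2_def)
      have K: "\<exists>u v. k = {u..v} \<and> u \<le> v \<and> a \<le> u \<and> v \<le> b \<and> u \<le> x \<and> x \<le> v \<and> measure lborel k = v - u \<and> Sup k = v \<and> Inf k = u"
        if "(x,k) \<in> p" for x k
      proof -
        have "x \<in> k" "k \<subseteq> {a..b}" "\<exists>u v. k = cbox u v"
          using tagged_division_ofD(2-4)[OF p that] by auto
        then obtain u v where "k = {u..v}" "u \<le> x" "x \<le> v" "{u..v} \<subseteq> {a..b}" by auto
        then show ?thesis by (intro exI[of _ u] exI[of _ v]) auto
      qed
      have "(\<Sum>(x,k)\<in>p. measure lborel k *\<^sub>R g x) - (f b - f a) = sum F p"
        using additive_tagged_division_1[OF ab p, of f]
        by (simp add: F_def sum_subtractf split_def)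
      also have "\<dots> = sum F p1 + sum F p2"
        using pp fin by (metis finite_subset sum.union_disjoint)
      finally have split: "(\<Sum>(x,k)\<in>p. measure lborel k *\<^sub>R g x) - (f b - f a) = sum F p1 + sum F p2" .
      have "norm (sum F p1) \<le> (\<Sum>(x,k)\<in>p1. \<eta> * (Sup k - Inf k))"
      proof (rule sum_norm_le, clarify)
        fix x k assume "(x,k) \<in> p1"
        then have xk: "(x,k) \<in> p" "x \<notin> N" by (auto simp: p1_def)
        from K[OF xk(1)] obtain u v where uv: "k = {u..v}" "u \<le> v" "a \<le> u" "v \<le> b" "u \<le> x" "x \<le> v"
          "measure lborel k = v - u" "Sup k = v" "Inf k = u" by blast
        have "{u..v} \<subseteq> ball x (r x)"
          using fineD[OF fine xk(1)] xk(2) uv(1) by (simp add: \<gamma>_def)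
        then have "u \<in> ball x (r x)" "v \<in> ball x (r x)" using uv(2) by auto
        then have uvr: "norm (u - x) < r x" "norm (v - x) < r x"
          by (auto simp: dist_norm norm_minus_commute)
        \<comment> \<open>The interval is cut at its tag, since the derivative estimate compares f
          only with its value at x. As u \<le> x \<le> v, the two distances add up to the length of
          the interval.\<close>
        have F: "F (x,k) = (f u - f x - (u - x) *\<^sub>R f' x) - (f v - f x - (v - x) *\<^sub>R f' x)"
          using uv xk by (simp add: F_def g_def algebra_simps)
        have "norm (F (x,k)) \<le> \<eta> * norm (u - x) + \<eta> * norm (v - x)"
          unfolding F using uv xk uvr
          by (intro order_trans[OF norm_triangle_ineq4] add_mono r(2)) auto
        also have "\<dots> = \<eta> * (Sup k - Inf k)"
          using uv by (simp add: algebra_simps)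
        finally show "norm (F (x,k)) \<le> \<eta> * (Sup k - Inf k)" .
      qed
      also have "\<dots> \<le> (\<Sum>(x,k)\<in>p. \<eta> * (Sup k - Inf k))"
        using fin pp K \<open>\<eta> > 0\<close> by (intro sum_mono2) fastforce+
      also have "\<dots> = \<eta> * (b - a)"
        using additive_tagged_division_1[OF ab p, of "\<lambda>x. x"]
        by (simp add: split_def flip: sum_distrib_left)
      also have "\<dots> < e / 2"
        using \<open>e > 0\<close> ab by (simp add: \<eta>_def field_simps)
      finally have 1: "norm (sum F p1) < e / 2" .
      define d where "d = snd ` p2"
      have p2: "p2 tagged_partial_division_of {a..b}"
        using p pp tagged_partial_division_subset tagged_division_of_def by blast
      have d: "d division_of \<Union>d" and p2': "p2 tagged_division_of \<Union>d"
        using partial_division_of_tagged_division[OF p2] tagged_partial_division_of_Union_self[OF p2]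
        by (simp_all add: d_def)
      have dU: "\<Union>d \<subseteq> U"
        using fineD[OF fine] by (force simp: d_def p2_def \<gamma>_def)
      have dab: "\<Union>d \<subseteq> {a..b}"
        using p pp by (force simp: d_def)
      have "(\<Sum>k\<in>d. Sup k - Inf k) = (\<Sum>k\<in>d. measure lebesgue k)"
      proof (rule sum.cong[OF refl])
        fix k assume "k \<in> d"
        with d dab obtain u v where "k = {u..v}" "u \<le> v" "Sup k = v" "Inf k = u"
          by (elim division_of_IccE)
        then show "Sup k - Inf k = measure lebesgue k" by simp
      qed
      also have "\<dots> = measure lebesgue (\<Union>d)"
        by (rule content_division[OF d])
      also have "\<dots> \<le> measure lebesgue U"
        using dU Um d by (intro measure_mono_fmeasurable) (auto intro: lmeasurable_division fmeasurableD)
      finally have "(\<Sum>k\<in>d. Sup k - Inf k) < \<delta>" using mU by simp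
      then have *: "(\<Sum>k\<in>d. norm (f (Sup k) - f (Inf k))) < e / 2"
        using \<delta>[OF d dab] by blast
      \<comment> \<open>Passing from tagged pairs to intervals requires a summand that vanishes on
        every interval with empty interior. This includes the empty set, where \<open>Sup\<close>
        and \<open>Inf\<close> carry no information, hence the default 0.\<close>
      define G where "G = (\<lambda>k. if k = {} then 0 else norm (f (Sup k) - f (Inf k)))"
      have "norm (sum F p2) \<le> (\<Sum>(x,k)\<in>p2. G k)"
      proof (rule sum_norm_le, clarify)
        fix x k assume "(x,k) \<in> p2"
        moreover from this have "k \<noteq> {}" using p2' by (metis empty_iff tagged_division_ofD(2))
        ultimately show "norm (F (x,k)) \<le> G k"
          by (auto simp: F_def G_def p2_def g_def norm_minus_commute)
      qed
      also have "\<dots> = (\<Sum>k\<in>d. G k)"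
        unfolding d_def
      proof (rule sum.over_tagged_division_lemma[OF p2'])
        fix u v :: real assume "box u v = {}"
        then have "cbox u v = {} \<or> u = v" by force
        then show "G (cbox u v) = 0" by (auto simp: G_def)
      qed
      also have "\<dots> = (\<Sum>k\<in>d. norm (f (Sup k) - f (Inf k)))"
        using division_ofD(3)[OF d] by (intro sum.cong) (auto simp: G_def)
      finally have 2: "norm (sum F p2) < e / 2" using * by simp
      show ?thesis
        unfolding split using 1 2 norm_triangle_ineq[of "sum F p1" "sum F p2"] by simp
    qed
    show "\<exists>\<gamma>. gauge \<gamma> \<and> (\<forall>p. p tagged_division_of {a..b} \<and> \<gamma> fine p \<longrightarrow>
        norm ((\<Sum>(x,k)\<in>p. measure lborel k *\<^sub>R g x) - (f b - f a)) < e)"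
      by (intro exI[of _ \<gamma>] conjI allI impI gauge small; elim conjE; assumption)
  qed
  then show ?thesis
    by (rule has_integral_spike[OF N, rotated]) (simp add: g_def)
qed


section \<open>Reflection of integrals and differentiation of indefinite integrals almost
  everywhere\<close>

lemma integral_reflect_interval:
  fixes f :: "real \<Rightarrow> 'a::euclidean_space"
  assumes "f integrable_on {c - b..c - a}"
  shows "((\<lambda>t. f (c - t)) has_integral integral {c - b..c - a} f) {a..b}"
proof -
  have "(f has_integral integral {c - b..c - a} f) (cbox (c - b) (c - a))"
    using assms by auto
  from has_integral_affinity[OF this, of "-1" c]
  have "((\<lambda>t. f (c - t)) has_integral integral {c - b..c - a} f) ((\<lambda>t. c - t) ` {c - b..c - a})"
    by (simp add: algebra_simps)
  then show ?thesis by simp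
qed

text \<open>Lebesgue differentiation over cubes with lower corner t; on the line this controls only
  the right difference quotient.\<close>

lemma right_derivative_indefinite_integral_AE:
  fixes f :: "real \<Rightarrow> 'a::euclidean_space"
  assumes "\<And>u v. f integrable_on {u..v}"
  obtains N where "negligible N"
    "\<And>t e. t \<notin> N \<Longrightarrow> 0 < e \<Longrightarrow>
      \<exists>d>0. \<forall>h. 0 < h \<and> h < d \<longrightarrow> norm (integral {t..t + h} f /\<^sub>R h - f t) < e"
proof -
  have "f integrable_on cbox u v" for u v
    using assms by simp
  then obtain N where N: "negligible N"
    "\<And>t e. t \<notin> N \<Longrightarrow> 0 < e \<Longrightarrow> \<exists>d>0. \<forall>h. 0 < h \<and> h < d \<longrightarrow>
      norm (integral (cbox t (t + h *\<^sub>R One)) f /\<^sub>R h ^ DIM(real) - f t) < e"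
    by (rule integrable_ccontinuous_explicit) blast
  show thesis
    by (rule that[OF N(1)]) (use N(2) in simp)
qed

text \<open>The left difference quotients are right quotients of the reflected function t -> g(-t),
  so the one-sided result is used twice. The exceptional set is the union of one null set with the
  mirror image of the other.\<close>

theorem has_vector_derivative_indefinite_integral_AE:
  fixes f :: "real \<Rightarrow> 'a::euclidean_space"
  assumes f: "f integrable_on {a..b}"
  shows "AE t in lebesgue_on {a..b}. ((\<lambda>t. integral {a..t} f) has_vector_derivative f t) (at t within {a..b})"
proof -
  \<comment> \<open>Extension by zero makes g integrable over every interval, including those that
    reach beyond {a..b}.\<close>
  define g where "g = (\<lambda>t. if t \<in> {a..b} then f t else 0)"
  have "g integrable_on UNIV"
    using f unfolding g_def by (simp only: integrable_restrict_UNIV)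
  then have gI: "g integrable_on {u..v}" for u v
    using integrable_on_subinterval by blast
  have hI: "(\<lambda>t. g (- t)) integrable_on {u..v}" for u v
    using gI[of "- v" "- u"] Henstock_Kurzweil_Integration.integrable_reflect_real[of g "- u" "- v"] by simp
  obtain N1 where N1: "negligible N1"
    "\<And>t e. t \<notin> N1 \<Longrightarrow> 0 < e \<Longrightarrow>
      \<exists>d>0. \<forall>h. 0 < h \<and> h < d \<longrightarrow> norm (integral {t..t + h} g /\<^sub>R h - g t) < e"
    by (rule right_derivative_indefinite_integral_AE[OF gI]) (rule that)
  obtain N2 where N2: "negligible N2"
    "\<And>t e. t \<notin> N2 \<Longrightarrow> 0 < e \<Longrightarrow>
      \<exists>d>0. \<forall>h. 0 < h \<and> h < d \<longrightarrow> norm (integral {t..t + h} (\<lambda>t. g (- t)) /\<^sub>R h - g (- t)) < e"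
    by (rule right_derivative_indefinite_integral_AE[OF hI]) (rule that)
  have neg: "negligible (N1 \<union> uminus ` N2)"
    using N1(1) N2(1)
    by (intro negligible_Un negligible_differentiable_image_negligible
        differentiable_on_minus differentiable_on_ident) auto
  have deriv: "((\<lambda>t. integral {a..t} f) has_vector_derivative f t) (at t within {a..b})"
    if t: "t \<in> {a..b}" "t \<notin> N1 \<union> uminus ` N2" for t
    unfolding has_vector_derivative_def has_derivative_within_alt
  proof (intro conjI allI impI bounded_linear_scaleR_left)
    fix e :: real assume "e > 0"
    have tN: "t \<notin> N1" "- t \<notin> N2" using t by force+
    obtain d1 where d1: "d1 > 0"
      "\<And>h. 0 < h \<Longrightarrow> h < d1 \<Longrightarrow> norm (integral {t..t + h} g /\<^sub>R h - g t) < e"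
      using N1(2)[OF tN(1) \<open>e > 0\<close>] by blast
    obtain d2 where d2: "d2 > 0"
      "\<And>h. 0 < h \<Longrightarrow> h < d2 \<Longrightarrow> norm (integral {-t..-t + h} (\<lambda>t. g (- t)) /\<^sub>R h - g (- (- t))) < e"
      using N2(2)[OF tN(2) \<open>e > 0\<close>] by blast
    have gt: "g t = f t" using t by (simp add: g_def)
    have eq: "integral {u..v} g = integral {u..v} f" if "a \<le> u" "v \<le> b" for u v
      using that by (intro Henstock_Kurzweil_Integration.integral_cong) (simp add: g_def)
    have scale: "norm (w - h *\<^sub>R z) \<le> e * h" if "norm (w /\<^sub>R h - z) < e" "h > 0" for w z :: 'a and h
    proof -
      have "w - h *\<^sub>R z = h *\<^sub>R (w /\<^sub>R h - z)" using that by (simp add: scaleR_diff_right)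
      then have "norm (w - h *\<^sub>R z) = h * norm (w /\<^sub>R h - z)" using that by simp
      then show ?thesis using that by (simp add: mult.commute)
    qed
    show "\<exists>d>0. \<forall>y\<in>{a..b}. norm (y - t) < d \<longrightarrow>
        norm (integral {a..y} f - integral {a..t} f - (y - t) *\<^sub>R f t) \<le> e * norm (y - t)"
    proof (intro exI[of _ "min d1 d2"] conjI ballI impI)
      fix y assume y: "y \<in> {a..b}" "norm (y - t) < min d1 d2"
      consider "y = t" | "t < y" | "y < t" by linarith
      then show "norm (integral {a..y} f - integral {a..t} f - (y - t) *\<^sub>R f t) \<le> e * norm (y - t)"
      proof cases
        case 2
        then have "integral {a..y} f - integral {a..t} f = integral {t..t + (y - t)} g"
          using Henstock_Kurzweil_Integration.integral_combine[of a t y f] t y eq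
            integrable_subinterval_real[OF f, of a y] by (auto simp: algebra_simps)
        then show ?thesis
          using scale[OF d1(2)[of "y - t"]] y 2 gt by simp
      next
        case 3
        have "integral {a..t} f - integral {a..y} f = integral {y..t} g"
          using Henstock_Kurzweil_Integration.integral_combine[of a y t f] t y eq 3
            integrable_subinterval_real[OF f, of a t] by (auto simp: algebra_simps)
        also have "\<dots> = integral {-t..-t + (t - y)} (\<lambda>t. g (- t))"
          using Henstock_Kurzweil_Integration.integral_reflect_real[of t y g] by simp
        finally have "norm (integral {a..t} f - integral {a..y} f - (t - y) *\<^sub>R f t) \<le> e * (t - y)"
          using scale[OF d2(2)[of "t - y"]] y 3 gt by simp
        moreover have "norm (integral {a..y} f - integral {a..t} f - (y - t) *\<^sub>R f t)
            = norm (integral {a..t} f - integral {a..y} f - (t - y) *\<^sub>R f t)"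
          by (subst norm_minus_commute) (simp add: algebra_simps)
        ultimately show ?thesis using 3 by simp
      qed simp
    qed (use d1 d2 in auto)
  qed
  show ?thesis
    by (subst AE_lebesgue_on_iff_negligible) (use deriv in \<open>auto intro!: negligible_subset[OF neg]\<close>)
qed

section \<open>Linear differential equations\<close>

lemma absolutely_continuous_on_subset:
  assumes "absolutely_continuous_on a b f" "a \<le> u" "v \<le> b"
  shows "absolutely_continuous_on u v f"
proof -
  have "S \<subseteq> {a..b}" if "S \<subseteq> {u..v}" for S
    using that assms by fastforce
  with assms(1) show ?thesis
    unfolding absolutely_continuous_on_def by meson
qed

lemma has_integral_absolutely_continuous_subinterval:
  fixes f :: "real \<Rightarrow> 'a::euclidean_space"
  assumes f: "absolutely_continuous_on a b f"
    and deriv: "AE t in lebesgue_on {a..b}. (f has_vector_derivative f' t) (at t within {a..b})"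
    and uv: "a \<le> u" "u \<le> v" "v \<le> b"
  shows "(f' has_integral (f v - f u)) {u..v}"
proof (rule fundamental_theorem_of_calculus_absolutely_continuous[OF uv(2)])
  show "absolutely_continuous_on u v f"
    using absolutely_continuous_on_subset[OF f] uv by blast
  have "{u..v} \<subseteq> {a..b}" using uv by auto
  then have "{t\<in>{u..v}. \<not> (f has_vector_derivative f' t) (at t within {u..v})}
      \<subseteq> {t\<in>{a..b}. \<not> (f has_vector_derivative f' t) (at t within {a..b})}"
    by (auto intro: has_vector_derivative_within_subset)
  then show "AE t in lebesgue_on {u..v}. (f has_vector_derivative f' t) (at t within {u..v})"
    using deriv by (auto simp: AE_lebesgue_on_iff_negligible intro: negligible_subset)
qed

text \<open>The norm of the matrix type is the Euclidean norm of all entries, not the operator norm;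
  Cauchy-Schwarz in each row gives the estimate.\<close>

lemma norm_matrix_vector_mult_le:
  fixes A :: "real^'n^'m"
  shows "norm (A *v x) \<le> norm A * norm x"
proof -
  have "norm (A *v x) = L2_set (\<lambda>i. norm ((A *v x) $ i)) UNIV"
    by (rule norm_vec_def)
  also have "\<dots> \<le> L2_set (\<lambda>i. norm x * norm (A $ i)) UNIV"
    using Cauchy_Schwarz_ineq2[of "A $ _" x]
    by (intro L2_set_mono) (auto simp: matrix_vector_mul_component mult.commute)
  also have "\<dots> = norm A * norm x"
    unfolding norm_vec_def[of A] by (simp add: L2_set_right_distrib mult.commute)
  finally show ?thesis .
qed

lemma bilinear_matrix_vector_mult: "bilinear (\<lambda>(A::real^'n^'m) x. A *v x)"
  unfolding bilinear_def
  by (auto intro!: linearI simp: matrix_vector_mult_add_rdistrib matrix_vector_right_distrib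
      scaleR_matrix_vector_assoc matrix_vector_mult_scaleR)

lemma borel_measurable_matrix_vector_mult:
  assumes "A \<in> borel_measurable (lebesgue_on {a..b::real})" "f \<in> borel_measurable (lebesgue_on {a..b})"
  shows "(\<lambda>t. (A t :: real^'n^'m) *v f t) \<in> borel_measurable (lebesgue_on {a..b})"
  using borel_measurable_bilinear[OF bilinear_matrix_vector_mult assms] by simp

text \<open>Raising the bound to at least 1 makes it positive, as needed once it serves as an
  exponential rate and as a divisor.\<close>

lemma L_infinity_AE_bound:
  assumes "L_infinity T A"
  obtains K where "K \<ge> 1" "AE t in lebesgue_on {0..T}. norm (A t) \<le> K"
proof -
  obtain K where "AE t in lebesgue_on {0..T}. norm (A t) \<le> K"
    using assms unfolding L_infinity_def by blast
  then have "AE t in lebesgue_on {0..T}. norm (A t) \<le> max 1 K" by eventually_elim auto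
  then show thesis by (rule that[rotated]) simp
qed

lemma integrable_matrix_vector_mult:
  fixes A :: "real \<Rightarrow> real^'n^'m"
  assumes A: "L_infinity T A" and f: "integrable (lebesgue_on {0..T}) f"
  shows "integrable (lebesgue_on {0..T}) (\<lambda>t. A t *v f t)"
proof -
  obtain K where K: "K \<ge> 1" "AE t in lebesgue_on {0..T}. norm (A t) \<le> K"
    by (rule L_infinity_AE_bound[OF A])
  show ?thesis
  proof (rule Bochner_Integration.integrable_bound)
    show "integrable (lebesgue_on {0..T}) (\<lambda>t. K * norm (f t))" using f by simp
    show "(\<lambda>t. A t *v f t) \<in> borel_measurable (lebesgue_on {0..T})"
      using A f by (intro borel_measurable_matrix_vector_mult) (auto simp: L_infinity_def)
    show "AE t in lebesgue_on {0..T}. norm (A t *v f t) \<le> norm (K * norm (f t))"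
      using K(2)
    proof eventually_elim
      case (elim t)
      then have "norm (A t) * norm (f t) \<le> K * norm (f t)" by (intro mult_right_mono) auto
      then show ?case
        using norm_matrix_vector_mult_le[of "A t" "f t"] K(1) by simp
    qed
  qed
qed

section \<open>Gronwall bound and Volterra equations in exponentially weighted norms\<close>

lemma has_integral_exp_mult:
  assumes "c \<noteq> 0" "0 \<le> (t::real)"
  shows "((\<lambda>s. exp (c * s)) has_integral (exp (c * t) - 1) / c) {0..t}"
proof -
  have "((\<lambda>s. exp (c * s)) has_integral exp (c * t) / c - exp (c * 0) / c) {0..t}"
    using assms by (intro fundamental_theorem_of_calculus)
      (auto intro!: derivative_eq_intros simp flip: has_real_derivative_iff_has_vector_derivative)
  then show ?thesis by (simp add: diff_divide_distrib)
qed

text \<open>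
  A weak Gronwall inequality: evaluating the hypothesis at the maximum of the weighted function
  \<open>exp (-2 K t) * \<phi> t\<close> bounds that maximum by \<open>C\<close> plus half of itself.
\<close>

lemma gronwall_weighted_max:
  fixes \<phi> :: "real \<Rightarrow> real"
  assumes cont: "continuous_on {0..T} \<phi>" and K: "K > 0" and C: "C \<ge> 0"
    and le: "\<And>t. t \<in> {0..T} \<Longrightarrow> \<phi> t \<le> C + K * integral {0..t} \<phi>"
    and t: "t \<in> {0..T}"
  shows "\<phi> t \<le> 2 * C * exp (2 * K * t)"
proof -
  define w where "w = (\<lambda>t. exp (- (2 * K * t)) * \<phi> t)"
  have "continuous_on {0..T} w"
    unfolding w_def by (intro continuous_intros cont)
  then obtain r where r: "r \<in> {0..T}" "\<And>s. s \<in> {0..T} \<Longrightarrow> w s \<le> w r"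
    using continuous_attains_sup[of "{0..T}" w] t by auto
  have "w r \<le> 2 * C"
  proof (cases "w r \<le> 0")
    case False
    have \<phi>: "\<phi> s \<le> w r * exp (2 * K * s)" if "s \<in> {0..r}" for s
    proof -
      have "\<phi> s = w s * exp (2 * K * s)" by (simp add: w_def exp_minus)
      also have "\<dots> \<le> w r * exp (2 * K * s)" using r(2)[of s] that r(1) by (intro mult_right_mono) auto
      finally show ?thesis .
    qed
    have "\<phi> integrable_on {0..r}"
      using cont r(1) by (intro integrable_continuous_real) (auto intro: continuous_on_subset)
    moreover have exp: "((\<lambda>s. w r * exp (2 * K * s)) has_integral w r * ((exp (2 * K * r) - 1) / (2 * K))) {0..r}"
      using K r(1) by (intro has_integral_mult_right has_integral_exp_mult) auto
    ultimately have "integral {0..r} \<phi> \<le> w r * ((exp (2 * K * r) - 1) / (2 * K))"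
      using integral_le[of \<phi> "{0..r}" "\<lambda>s. w r * exp (2 * K * s)"] \<phi>
      by (simp only: integral_unique[OF exp] has_integral_integrable[OF exp])
    then have "K * integral {0..r} \<phi> \<le> K * (w r * ((exp (2 * K * r) - 1) / (2 * K)))"
      using K by (intro mult_left_mono) auto
    then have "\<phi> r \<le> C + w r * (exp (2 * K * r) - 1) / 2"
      using le[OF r(1)] K by simp
    then have "w r \<le> exp (- (2 * K * r)) * (C + w r * (exp (2 * K * r) - 1) / 2)"
      unfolding w_def by (intro mult_left_mono) auto
    also have "\<dots> = exp (- (2 * K * r)) * (C - w r / 2) + w r / 2"
      by (simp add: exp_minus field_simps)
    finally have "w r / 2 \<le> exp (- (2 * K * r)) * (C - w r / 2)" by simp
    \<comment> \<open>If w(r) exceeded 2 C, the right-hand side of the preceding inequality would be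
      negative although its left-hand side is positive.\<close>
    moreover have "exp (- (2 * K * r)) * (C - w r / 2) < 0" if "C < w r / 2"
      using that by (simp add: mult_pos_neg)
    ultimately show ?thesis using False by force
  qed (use C in auto)
  then have "w t \<le> 2 * C" using r(2)[OF t] by simp
  then have "exp (2 * K * t) * w t \<le> exp (2 * K * t) * (2 * C)" by (intro mult_left_mono) auto
  then show ?thesis by (simp add: w_def exp_minus field_simps)
qed

text \<open>The fixed point is sought for \<xi>(t) = exp(-2 K t) x(t), which turns the weighted norm
  of x into the plain sup norm of the complete space of bounded continuous functions. In this
  scaling the Volterra operator has Lipschitz constant 1/2 whatever the length T, so the interval is
  not subdivided.\<close>

lemma volterra_solution_exists:
  fixes A :: "real \<Rightarrow> real^'n^'n" and c :: "real \<Rightarrow> real^'n"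
  assumes T: "0 \<le> T" and A: "A \<in> borel_measurable (lebesgue_on {0..T})"
    and K: "K > 0" "\<And>t. norm (A t) \<le> K" and c: "continuous_on {0..T} c"
  shows "\<exists>x. continuous_on {0..T} x \<and> (\<forall>t\<in>{0..T}. x t = c t + integral {0..t} (\<lambda>s. A s *v x s))"
proof -
  have Linf: "L_infinity T A" using A K(2) by (auto simp: L_infinity_def)
  have int: "(\<lambda>s. A s *v y s) integrable_on {0..t}" if "continuous_on {0..T} y" "t \<le> T" for y t
  proof (rule integrable_on_subinterval)
    show "(\<lambda>s. A s *v y s) integrable_on {0..T}"
      using integrable_matrix_vector_mult[OF Linf continuous_imp_integrable_real[OF that(1)]]
      by (simp add: integrable_on_lebesgue_on)
  qed (use that in auto)
  define G where "G = (\<lambda>(\<xi> :: real \<Rightarrow>\<^sub>C (real^'n)) t. exp (- (2 * K * t)) *\<^sub>R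
    (c t + integral {0..t} (\<lambda>s. A s *v (exp (2 * K * s) *\<^sub>R \<xi> s))))"
  \<comment> \<open>Elements of the function space live on the whole line; \<open>clamp\<close>
    extends the image constantly outside [0,T], which keeps it bounded and continuous.\<close>
  define F where "F = (\<lambda>\<xi>. Bcontfun (\<lambda>t. G \<xi> (clamp 0 T t)))"
  have cont: "continuous_on {0..T} (\<lambda>s. exp (2 * K * s) *\<^sub>R apply_bcontfun \<xi> s)" for \<xi> :: "real \<Rightarrow>\<^sub>C (real^'n)"
    by (intro continuous_intros) auto
  have "continuous_on (cbox 0 T) (G \<xi>)" for \<xi>
    unfolding G_def box_real
    by (intro continuous_intros c indefinite_integral_continuous_1 int cont order_refl)
  then have "(\<lambda>t. G \<xi> (clamp 0 T t)) \<in> bcontfun" for \<xi>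
    unfolding bcontfun_def
    by (simp add: clamp_continuous_on clamp_bounded compact_imp_bounded compact_continuous_image)
  then have F: "apply_bcontfun (F \<xi>) t = G \<xi> (clamp 0 T t)" for \<xi> t
    unfolding F_def by (simp add: Bcontfun_inverse)
  have clamp: "clamp 0 T t \<in> {0..T}" for t
    using T clamp_in_interval[of 0 T t] by simp
  have GG: "dist (G \<xi> t) (G \<zeta> t) \<le> 1/2 * dist \<xi> \<zeta>" if t: "t \<in> {0..T}" for \<xi> \<zeta> t
  proof -
    let ?I = "\<lambda>\<xi>. integral {0..t} (\<lambda>s. A s *v (exp (2 * K * s) *\<^sub>R apply_bcontfun \<xi> s))"
    have tT: "t \<le> T" "0 \<le> t" using t by auto
    have exp: "((\<lambda>s. K * dist \<xi> \<zeta> * exp (2 * K * s)) has_integral K * dist \<xi> \<zeta> * ((exp (2 * K * t) - 1) / (2 * K))) {0..t}"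
      using K tT by (intro has_integral_mult_right has_integral_exp_mult) auto
    have "dist (G \<xi> t) (G \<zeta> t) = exp (- (2 * K * t)) * norm (?I \<xi> - ?I \<zeta>)"
      by (simp add: G_def dist_norm flip: scaleR_diff_right)
    also have "?I \<xi> - ?I \<zeta> = integral {0..t} (\<lambda>s. A s *v (exp (2 * K * s) *\<^sub>R \<xi> s) - A s *v (exp (2 * K * s) *\<^sub>R \<zeta> s))"
      by (rule Henstock_Kurzweil_Integration.integral_diff[symmetric]) (intro int cont tT)+
    also have "norm \<dots> \<le> integral {0..t} (\<lambda>s. K * dist \<xi> \<zeta> * exp (2 * K * s))"
    proof (rule integral_norm_bound_integral)
      fix s
      have "norm (A s *v (exp (2 * K * s) *\<^sub>R \<xi> s) - A s *v (exp (2 * K * s) *\<^sub>R \<zeta> s))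
          = norm (A s *v (exp (2 * K * s) *\<^sub>R (\<xi> s - \<zeta> s)))"
        by (simp add: matrix_vector_mult_diff_distrib scaleR_diff_right)
      also have "\<dots> \<le> norm (A s) * (exp (2 * K * s) * dist (\<xi> s) (\<zeta> s))"
        using norm_matrix_vector_mult_le[of "A s" "exp (2 * K * s) *\<^sub>R (\<xi> s - \<zeta> s)"] by (simp add: dist_norm)
      also have "\<dots> \<le> K * (exp (2 * K * s) * dist \<xi> \<zeta>)"
        using K by (intro mult_mono dist_bounded) auto
      finally show "norm (A s *v (exp (2 * K * s) *\<^sub>R \<xi> s) - A s *v (exp (2 * K * s) *\<^sub>R \<zeta> s))
          \<le> K * dist \<xi> \<zeta> * exp (2 * K * s)" by (simp add: mult_ac)
    next
      show "(\<lambda>s. A s *v (exp (2 * K * s) *\<^sub>R \<xi> s) - A s *v (exp (2 * K * s) *\<^sub>R \<zeta> s)) integrable_on {0..t}"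
        by (intro Henstock_Kurzweil_Integration.integrable_diff int cont tT)
      show "(\<lambda>s. K * dist \<xi> \<zeta> * exp (2 * K * s)) integrable_on {0..t}"
        using exp by blast
    qed
    also have "\<dots> = K * dist \<xi> \<zeta> * ((exp (2 * K * t) - 1) / (2 * K))"
      by (rule integral_unique[OF exp])
    \<comment> \<open>The weight absorbs the growth of the integral, and the constant 1/2 is what
      remains of K / (2 K).\<close>
    also have "exp (- (2 * K * t)) * \<dots> = 1/2 * dist \<xi> \<zeta> * (1 - exp (- (2 * K * t)))"
      using K by (simp add: exp_minus field_simps)
    also have "\<dots> \<le> 1/2 * dist \<xi> \<zeta> * 1"
      by (intro mult_left_mono) auto
    finally show ?thesis by simp
  qed
  have "dist (F \<xi>) (F \<zeta>) \<le> 1/2 * dist \<xi> \<zeta>" for \<xi> \<zeta>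
    by (rule dist_bound) (use F GG[OF clamp] in simp)
  then obtain \<xi> where \<xi>: "F \<xi> = \<xi>"
    using banach_fix_type[of "1/2" F] by auto
  define x where "x = (\<lambda>t. exp (2 * K * t) *\<^sub>R apply_bcontfun \<xi> t)"
  have "x t = c t + integral {0..t} (\<lambda>s. A s *v x s)" if t: "t \<in> {0..T}" for t
  proof -
    have "clamp 0 T t = t" using t by simp
    then have "apply_bcontfun \<xi> t = G \<xi> t" using F[of \<xi> t] \<xi> by simp
    then show ?thesis by (simp add: x_def G_def exp_minus)
  qed
  moreover have "continuous_on {0..T} x" unfolding x_def by (rule cont)
  ultimately show ?thesis by blast
qed


text \<open>With an arbitrary source in place of B u, the state equation, the equation for the
  difference of two solutions and the time-reversed adjoint equation all become instances of one
  notion.\<close>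

definition linear_ode_solution ::
    "real \<Rightarrow> (real \<Rightarrow> real^'n^'n) \<Rightarrow> (real \<Rightarrow> real^'n) \<Rightarrow> real^'n \<Rightarrow> (real \<Rightarrow> real^'n) \<Rightarrow> bool" where
  "linear_ode_solution T A f x0 x \<longleftrightarrow> absolutely_continuous_on 0 T x \<and> x 0 = x0 \<and>
     (AE t in lebesgue_on {0..T}. (x has_vector_derivative (A t *v x t + f t)) (at t within {0..T}))"

lemma lq_trajectory_iff_linear_ode_solution:
  "lq_trajectory T A B x0 u x \<longleftrightarrow> linear_ode_solution T A (\<lambda>t. B t *v u t) x0 x"
  by (simp add: lq_trajectory_def linear_ode_solution_def)

lemma linear_ode_solution_cong_AE:
  assumes "AE t in lebesgue_on {0..T}. A t = A' t" "AE t in lebesgue_on {0..T}. f t = f' t"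
  shows "linear_ode_solution T A f x0 x \<longleftrightarrow> linear_ode_solution T A' f' x0 x"
proof -
  have "(AE t in lebesgue_on {0..T}. (x has_vector_derivative (A t *v x t + f t)) (at t within {0..T}))
      \<longleftrightarrow> (AE t in lebesgue_on {0..T}. (x has_vector_derivative (A' t *v x t + f' t)) (at t within {0..T}))"
    by (rule eventually_subst) (use assms in \<open>eventually_elim, simp\<close>)
  then show ?thesis by (simp add: linear_ode_solution_def)
qed

lemma linear_ode_solution_lincomb:
  assumes "linear_ode_solution T A f x0 x" "linear_ode_solution T A g y0 y"
  shows "linear_ode_solution T A (\<lambda>t. \<alpha> *\<^sub>R f t + \<beta> *\<^sub>R g t) (\<alpha> *\<^sub>R x0 + \<beta> *\<^sub>R y0) (\<lambda>t. \<alpha> *\<^sub>R x t + \<beta> *\<^sub>R y t)"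
proof -
  have "AE t in lebesgue_on {0..T}. (x has_vector_derivative (A t *v x t + f t)) (at t within {0..T})"
    "AE t in lebesgue_on {0..T}. (y has_vector_derivative (A t *v y t + g t)) (at t within {0..T})"
    using assms by (auto simp: linear_ode_solution_def)
  then have "AE t in lebesgue_on {0..T}. ((\<lambda>t. \<alpha> *\<^sub>R x t + \<beta> *\<^sub>R y t) has_vector_derivative
      (A t *v (\<alpha> *\<^sub>R x t + \<beta> *\<^sub>R y t) + (\<alpha> *\<^sub>R f t + \<beta> *\<^sub>R g t))) (at t within {0..T})"
  proof eventually_elim
    case (elim t)
    have "A t *v (\<alpha> *\<^sub>R x t + \<beta> *\<^sub>R y t) + (\<alpha> *\<^sub>R f t + \<beta> *\<^sub>R g t)
        = \<alpha> *\<^sub>R (A t *v x t + f t) + \<beta> *\<^sub>R (A t *v y t + g t)"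
      by (simp add: matrix_vector_right_distrib matrix_vector_mult_scaleR scaleR_add_right)
    then show ?case
      using has_vector_derivative_add[OF has_vector_derivative_scaleR[OF DERIV_const elim(1), of \<alpha>]
          has_vector_derivative_scaleR[OF DERIV_const elim(2), of \<beta>]] by simp
  qed
  with assms show ?thesis
    by (simp add: linear_ode_solution_def absolutely_continuous_on_lincomb)
qed

lemma integral_equation_imp_absolutely_continuous:
  fixes x h :: "real \<Rightarrow> 'a::euclidean_space"
  assumes h: "integrable (lebesgue_on {a..b}) h"
    and x: "\<And>t. t \<in> {a..b} \<Longrightarrow> x t = c + integral {a..t} h"
  shows "absolutely_continuous_on a b x"
    and "AE t in lebesgue_on {a..b}. (x has_vector_derivative h t) (at t within {a..b})"
proof -
  show "absolutely_continuous_on a b x"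
    using absolutely_continuous_on_integral[OF h, of c]
    by (rule absolutely_continuous_on_cong) (simp add: x)
  have deriv: "AE t in lebesgue_on {a..b}. ((\<lambda>t. integral {a..t} h) has_vector_derivative h t) (at t within {a..b})"
    using h by (intro has_vector_derivative_indefinite_integral_AE integrable_on_lebesgue_on) auto
  show "AE t in lebesgue_on {a..b}. (x has_vector_derivative h t) (at t within {a..b})"
    using deriv AE_space[of "lebesgue_on {a..b}"]
  proof eventually_elim
    case (elim t)
    have d: "((\<lambda>t. c + integral {a..t} h) has_vector_derivative h t) (at t within {a..b})"
      using has_vector_derivative_add[OF has_vector_derivative_const[of c] elim(1)] by simp
    show ?case
      by (rule has_vector_derivative_transform[OF _ x d]) (use elim(2) in simp_all)
  qed
qed

lemma linear_ode_solution_has_integral: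
  assumes "linear_ode_solution T A f x0 x" "t \<in> {0..T}"
  shows "((\<lambda>s. A s *v x s + f s) has_integral (x t - x0)) {0..t}"
  using assms has_integral_absolutely_continuous_subinterval[of 0 T x "\<lambda>s. A s *v x s + f s" 0 t]
  by (auto simp: linear_ode_solution_def)

text \<open>The constant is quantified before the source and the initial value. This uniformity is
  what later bounds y_u by the norm of u, and the adjoint state by its source and end value.\<close>

lemma linear_ode_solvable:
  fixes A :: "real \<Rightarrow> real^'n^'n"
  assumes T: "0 \<le> T" and A: "L_infinity T A"
  obtains C where "C \<ge> 0"
    "\<And>f x0. integrable (lebesgue_on {0..T}) f \<Longrightarrow> \<exists>x. linear_ode_solution T A f x0 x"
    "\<And>f x0 x t. integrable (lebesgue_on {0..T}) f \<Longrightarrow> linear_ode_solution T A f x0 x \<Longrightarrow> t \<in> {0..T} \<Longrightarrow>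
      norm (x t) \<le> C * (norm x0 + (LINT s|lebesgue_on {0..T}. norm (f s)))"
proof -
  obtain K where K: "K \<ge> 1" "AE t in lebesgue_on {0..T}. norm (A t) \<le> K"
    by (rule L_infinity_AE_bound[OF A])
  \<comment> \<open>The bound on A holds only almost everywhere, whereas the fixed-point
    construction asks for it at every point. Zeroing A where the bound fails does not change which
    functions are solutions.\<close>
  define A' where "A' = (\<lambda>t. if norm (A t) \<le> K then A t else 0)"
  have [measurable]: "A \<in> borel_measurable (lebesgue_on {0..T})"
    using A by (simp add: L_infinity_def)
  have A'm: "A' \<in> borel_measurable (lebesgue_on {0..T})"
    unfolding A'_def by measurable
  have A'K: "norm (A' t) \<le> K" for t using K(1) by (simp add: A'_def)
  have A': "L_infinity T A'" using A'm A'K by (auto simp: L_infinity_def)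
  have "AE t in lebesgue_on {0..T}. A t = A' t"
    using K(2) by eventually_elim (simp add: A'_def)
  then have eq: "linear_ode_solution T A f x0 x \<longleftrightarrow> linear_ode_solution T A' f x0 x" for f x0 x
    by (intro linear_ode_solution_cong_AE) auto
  show thesis
  \<comment> \<open>This is the Gronwall factor 2 * exp(2 K t) at its largest value t = T.\<close>
  proof (rule that[of "2 * exp (2 * K * T)"])
    fix f :: "real \<Rightarrow> real^'n" and x0 assume f: "integrable (lebesgue_on {0..T}) f"
    then have fI: "f integrable_on {0..T}" by (simp add: integrable_on_lebesgue_on)
    have c: "continuous_on {0..T} (\<lambda>t. x0 + integral {0..t} f)"
      by (intro continuous_intros indefinite_integral_continuous_1 fI)
    have "K > 0" using K(1) by simp
    from volterra_solution_exists[OF T A'm this A'K c]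
    obtain x where x: "continuous_on {0..T} x"
      "\<And>t. t \<in> {0..T} \<Longrightarrow> x t = (x0 + integral {0..t} f) + integral {0..t} (\<lambda>s. A' s *v x s)"
      by blast
    have Ax: "integrable (lebesgue_on {0..T}) (\<lambda>s. A' s *v x s)"
      using x(1) by (intro integrable_matrix_vector_mult[OF A'] continuous_imp_integrable_real)
    have "x t = x0 + integral {0..t} (\<lambda>s. A' s *v x s + f s)" if t: "t \<in> {0..T}" for t
    proof -
      have sub: "{0..t} \<subseteq> {0..T}" using t by auto
      have "(\<lambda>s. A' s *v x s) integrable_on {0..t}" "f integrable_on {0..t}"
        using fI integrable_on_lebesgue_on[OF Ax] sub by (auto intro: integrable_subinterval_real)
      then show ?thesis
        using x(2)[OF t] by (simp add: Henstock_Kurzweil_Integration.integral_add)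
    qed
    note x' = integral_equation_imp_absolutely_continuous[OF _ this]
    have "linear_ode_solution T A' f x0 x"
      using x' Ax f x(2)[of 0] T by (auto simp: linear_ode_solution_def)
    then show "\<exists>x. linear_ode_solution T A f x0 x" using eq by blast
  next
    fix f :: "real \<Rightarrow> real^'n" and x0 x t
    assume f: "integrable (lebesgue_on {0..T}) f" and "linear_ode_solution T A f x0 x" and t: "t \<in> {0..T}"
    then have x: "linear_ode_solution T A' f x0 x" using eq by simp
    then have cont: "continuous_on {0..T} x"
      by (simp add: linear_ode_solution_def absolutely_continuous_on_imp_continuous_on)
    have nf: "(\<lambda>s. norm (f s)) integrable_on {0..T}"
      using f by (simp add: integrable_on_lebesgue_on)
    have le: "norm (x r) \<le> (norm x0 + (LINT s|lebesgue_on {0..T}. norm (f s))) + K * integral {0..r} (\<lambda>s. norm (x s))"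
      if r: "r \<in> {0..T}" for r
    proof -
      have sub: "{0..r} \<subseteq> {0..T}" using r by auto
      have nf': "(\<lambda>s. norm (f s)) integrable_on {0..r}"
        using integrable_subinterval_real[OF nf sub] .
      have nx': "(\<lambda>s. K * norm (x s)) integrable_on {0..r}"
        using cont sub by (intro integrable_continuous_real continuous_intros) (auto intro: continuous_on_subset)
      have I: "((\<lambda>s. A' s *v x s + f s) has_integral (x r - x0)) {0..r}"
        by (rule linear_ode_solution_has_integral[OF x r])
      have "norm (x r) \<le> norm x0 + norm (x r - x0)"
        by (metis add.commute diff_add_cancel norm_triangle_ineq)
      also have "norm (x r - x0) = norm (integral {0..r} (\<lambda>s. A' s *v x s + f s))"
        using I by (simp add: integral_unique)
      also have "\<dots> \<le> integral {0..r} (\<lambda>s. K * norm (x s) + norm (f s))"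
      proof (rule integral_norm_bound_integral)
        fix s
        have "norm (A' s *v x s) \<le> K * norm (x s)"
          using norm_matrix_vector_mult_le[of "A' s" "x s"] mult_right_mono[OF A'K[of s], of "norm (x s)"] by simp
        then show "norm (A' s *v x s + f s) \<le> K * norm (x s) + norm (f s)"
          by (intro norm_triangle_mono) auto
      qed (use I nf' nx' in \<open>auto intro: Henstock_Kurzweil_Integration.integrable_add\<close>)
      also have "\<dots> = K * integral {0..r} (\<lambda>s. norm (x s)) + integral {0..r} (\<lambda>s. norm (f s))"
        using nx' nf' by (subst Henstock_Kurzweil_Integration.integral_add) auto
      also have "integral {0..r} (\<lambda>s. norm (f s)) \<le> integral {0..T} (\<lambda>s. norm (f s))"
        by (rule integral_subset_le[OF sub nf' nf]) simp
      also have "\<dots> = (LINT s|lebesgue_on {0..T}. norm (f s))"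
        using f by (simp add: lebesgue_integral_eq_integral)
      finally show ?thesis by simp
    qed
    have C0: "0 \<le> norm x0 + (LINT s|lebesgue_on {0..T}. norm (f s))"
      by (intro add_nonneg_nonneg Bochner_Integration.integral_nonneg) auto
    have "norm (x t) \<le> 2 * (norm x0 + (LINT s|lebesgue_on {0..T}. norm (f s))) * exp (2 * K * t)"
      using K(1) cont by (intro gronwall_weighted_max[OF _ _ C0 le t] continuous_intros) auto
    also have "\<dots> \<le> 2 * (norm x0 + (LINT s|lebesgue_on {0..T}. norm (f s))) * exp (2 * K * T)"
      using K(1) t C0 by (intro mult_left_mono) auto
    finally show "norm (x t) \<le> 2 * exp (2 * K * T) * (norm x0 + (LINT s|lebesgue_on {0..T}. norm (f s)))"
      by (simp add: algebra_simps)
  qed simp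
qed

text \<open>The difference of two solutions has zero source and zero initial value, so the a priori
  bound forces it to vanish.\<close>

lemma linear_ode_solution_unique:
  fixes A :: "real \<Rightarrow> real^'n^'n"
  assumes "0 \<le> T" "L_infinity T A"
    and x: "linear_ode_solution T A f x0 x" and y: "linear_ode_solution T A f x0 y" and t: "t \<in> {0..T}"
  shows "x t = y t"
proof -
  obtain C where C: "\<And>f x0 x t. integrable (lebesgue_on {0..T}) f \<Longrightarrow> linear_ode_solution T A f x0 x \<Longrightarrow>
      t \<in> {0..T} \<Longrightarrow> norm (x t) \<le> C * (norm x0 + (LINT s|lebesgue_on {0..T}. norm (f s)))"
    by (rule linear_ode_solvable[OF assms(1,2)]) blast
  have "linear_ode_solution T A (\<lambda>t. 0) 0 (\<lambda>t. x t - y t)"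
    using linear_ode_solution_lincomb[OF x y, of 1 "- 1"] by simp
  from C[OF _ this t] show ?thesis by simp
qed

section \<open>Time reversal and the adjoint equation\<close>

lemma AE_lebesgue_on_reflect:
  assumes "AE t in lebesgue_on {0..T::real}. P t"
  shows "AE t in lebesgue_on {0..T}. P (T - t)"
proof -
  have "negligible {t\<in>{0..T}. \<not> P t}"
    using assms by (simp add: AE_lebesgue_on_iff_negligible)
  then have "negligible ((\<lambda>t. T - t) ` {t\<in>{0..T}. \<not> P t})"
    by (intro negligible_differentiable_image_negligible differentiable_on_diff
        differentiable_on_const differentiable_on_ident) auto
  moreover have "{t\<in>{0..T}. \<not> P (T - t)} \<subseteq> (\<lambda>t. T - t) ` {t\<in>{0..T}. \<not> P t}"
    by (auto intro!: image_eqI[where x = "T - _"])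
  ultimately show ?thesis
    by (auto simp: AE_lebesgue_on_iff_negligible intro: negligible_subset)
qed

lemma measurable_lebesgue_on_reflect:
  "(\<lambda>t. T - t) \<in> lebesgue_on {0..T::real} \<rightarrow>\<^sub>M lebesgue_on {0..T}"
proof (rule measurable_restrict_space3)
  show "(\<lambda>t. T - t) \<in> lebesgue \<rightarrow>\<^sub>M lebesgue"
    using lebesgue_affine_measurable[where c = "\<lambda>_::real. - 1" and t = T] by simp
qed auto

lemma L_infinity_reflect: "L_infinity T A \<Longrightarrow> L_infinity T (\<lambda>t. A (T - t))"
  unfolding L_infinity_def
  by (auto intro: measurable_compose[OF measurable_lebesgue_on_reflect] dest: AE_lebesgue_on_reflect)

lemma norm_transpose: "norm (transpose A) = norm (A :: real^'n^'m)"
proof -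
  have "(\<Sum>i\<in>UNIV. \<Sum>j\<in>UNIV. (A $ j $ i)\<^sup>2) = (\<Sum>i\<in>UNIV. \<Sum>j\<in>UNIV. (A $ i $ j)\<^sup>2)"
    by (rule sum.swap)
  then show ?thesis
    by (simp add: norm_vec_def L2_set_def transpose_def sum_nonneg)
qed

lemma linear_transpose: "linear (transpose :: real^'n^'m \<Rightarrow> real^'m^'n)"
  by (rule linearI) (simp_all add: transpose_def vec_eq_iff)

lemma L_infinity_transpose:
  fixes A :: "real \<Rightarrow> real^'n^'m"
  assumes "L_infinity T A"
  shows "L_infinity T (\<lambda>t. transpose (A t))"
proof -
  have "continuous_on UNIV (transpose :: real^'n^'m \<Rightarrow> real^'m^'n)"
    by (intro linear_continuous_on) (simp add: linear_transpose linear_linear)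
  then have "(transpose :: real^'n^'m \<Rightarrow> real^'m^'n) \<in> borel_measurable borel"
    by (rule borel_measurable_continuous_onI)
  then show ?thesis
    using assms by (auto simp: L_infinity_def norm_transpose intro: measurable_compose)
qed

lemma integrable_lebesgue_on_reflect:
  fixes f :: "real \<Rightarrow> 'a::euclidean_space"
  assumes f: "integrable (lebesgue_on {0..T}) f"
  shows "integrable (lebesgue_on {0..T}) (\<lambda>t. f (T - t))"
    and "(LINT t|lebesgue_on {0..T}. f (T - t)) = (LINT t|lebesgue_on {0..T}. f t)"
proof -
  have r: "((\<lambda>t. g (T - t)) has_integral integral {0..T} g) {0..T}"
    if "integrable (lebesgue_on {0..T}) g" for g :: "real \<Rightarrow> 'b::euclidean_space"
    using that integral_reflect_interval[of g T T 0] by (simp add: integrable_on_lebesgue_on)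
  \<comment> \<open>The reflection formula speaks of gauge integrals; applying it to the norm of f
    as well yields absolute integrability, hence Lebesgue integrability.\<close>
  show int: "integrable (lebesgue_on {0..T}) (\<lambda>t. f (T - t))"
    using r[OF f] r[of "\<lambda>t. norm (f t)"] f
    by (intro absolutely_integrable_imp_integrable absolutely_integrable_onI) auto
  show "(LINT t|lebesgue_on {0..T}. f (T - t)) = (LINT t|lebesgue_on {0..T}. f t)"
    using integral_unique[OF r[OF f]] f int by (simp add: lebesgue_integral_eq_integral)
qed

lemma inner_matrix_vector_mult_transpose:
  fixes A :: "real^'n^'m"
  shows "x \<bullet> (A *v y) = (transpose A *v x) \<bullet> y"
  by (simp add: dot_lmul_matrix)

text \<open>
  The adjoint state \<open>p\<close> solves \<open>- p' = A\<^sup>T p + q\<close>, \<open>p T = m\<close>; it is obtained from a forward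
  equation by reversing time.
\<close>

lemma adjoint_solution_from_reversed:
  fixes A :: "real \<Rightarrow> real^'n^'n"
  assumes T: "0 \<le> T" and A: "L_infinity T A" and q: "integrable (lebesgue_on {0..T}) q"
    and r: "linear_ode_solution T (\<lambda>t. transpose (A (T - t))) (\<lambda>t. q (T - t)) m r"
  defines "p \<equiv> \<lambda>t. r (T - t)"
  shows "absolutely_continuous_on 0 T p"
    and "AE t in lebesgue_on {0..T}. (p has_vector_derivative - (transpose (A t) *v p t + q t)) (at t within {0..T})"
proof -
  define h where "h = (\<lambda>t. transpose (A t) *v p t + q t)"
  have rc: "continuous_on {0..T} r"
    using r by (simp add: linear_ode_solution_def absolutely_continuous_on_imp_continuous_on)
  have pc: "continuous_on {0..T} p"
    unfolding p_def by (rule continuous_on_compose2[OF rc]) (auto intro!: continuous_intros)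
  have h: "integrable (lebesgue_on {0..T}) h"
    unfolding h_def
    by (intro Bochner_Integration.integrable_add q integrable_matrix_vector_mult[OF L_infinity_transpose[OF A]]
        continuous_imp_integrable_real pc)
  have hI: "h integrable_on {0..T}" using h by (simp add: integrable_on_lebesgue_on)
  \<comment> \<open>Reflecting the equation for r gives p(t) = m + integral of h over [t,T].
    Subtracting from the integral over [0,T] turns this into a forward equation whose constant term
    is p(0).\<close>
  have "p t = (m + integral {0..T} h) + integral {0..t} (\<lambda>s. - h s)" if t: "t \<in> {0..T}" for t
  proof -
    have I: "((\<lambda>s. h (T - s)) has_integral (p t - m)) {T - T..T - t}"
      using linear_ode_solution_has_integral[OF r, of "T - t"] t by (simp add: h_def p_def)
    have "((\<lambda>s. h (T - (T - s))) has_integral (p t - m)) {t..T}"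
      using integral_reflect_interval[OF has_integral_integrable[OF I]] unfolding integral_unique[OF I] .
    then have "p t = m + integral {t..T} h" by (simp add: integral_unique)
    moreover have "integral {0..T} h = integral {0..t} h + integral {t..T} h"
      using t hI by (intro Henstock_Kurzweil_Integration.integral_combine[symmetric]) auto
    ultimately show ?thesis by simp
  qed
  note eq = this
  have hneg: "integrable (lebesgue_on {0..T}) (\<lambda>s. - h s)" using h by simp
  show "absolutely_continuous_on 0 T p"
    by (rule integral_equation_imp_absolutely_continuous(1)[OF hneg eq])
  show "AE t in lebesgue_on {0..T}. (p has_vector_derivative - (transpose (A t) *v p t + q t)) (at t within {0..T})"
    using integral_equation_imp_absolutely_continuous(2)[OF hneg eq] by (simp only: h_def)
qed

text \<open>Integrate the derivative of the inner product of p and y. The terms containing A cancel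
  because p is driven by the transpose, the boundary term at 0 vanishes with y(0), and the one at T
  is the prescribed end value m paired with y(T).\<close>

lemma adjoint_pairing:
  fixes A :: "real \<Rightarrow> real^'n^'n"
  assumes T: "0 \<le> T" and A: "L_infinity T A" and q: "integrable (lebesgue_on {0..T}) q"
    and r: "linear_ode_solution T (\<lambda>t. transpose (A (T - t))) (\<lambda>t. q (T - t)) m r"
    and y: "linear_ode_solution T A f 0 y"
  shows "((\<lambda>t. r (T - t) \<bullet> f t - q t \<bullet> y t) has_integral (m \<bullet> y T)) {0..T}"
proof -
  define p where "p = (\<lambda>t. r (T - t))"
  have p: "absolutely_continuous_on 0 T p"
    "AE t in lebesgue_on {0..T}. (p has_vector_derivative - (transpose (A t) *v p t + q t)) (at t within {0..T})"
    using adjoint_solution_from_reversed[OF T A q r] by (simp_all add: p_def)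
  have "AE t in lebesgue_on {0..T}. (y has_vector_derivative (A t *v y t + f t)) (at t within {0..T})"
    using y by (simp add: linear_ode_solution_def)
  with p(2) have "AE t in lebesgue_on {0..T}.
      ((\<lambda>t. p t \<bullet> y t) has_vector_derivative (p t \<bullet> f t - q t \<bullet> y t)) (at t within {0..T})"
  proof eventually_elim
    case (elim t)
    have eq: "p t \<bullet> (A t *v y t + f t) + (- (transpose (A t) *v p t + q t)) \<bullet> y t = p t \<bullet> f t - q t \<bullet> y t"
      by (simp add: inner_matrix_vector_mult_transpose inner_add_left inner_add_right inner_diff_left)
    then show ?case
      using bounded_bilinear.has_vector_derivative[OF bounded_bilinear_inner elim] by (simp only: eq)
  qed
  moreover have "absolutely_continuous_on 0 T (\<lambda>t. p t \<bullet> y t)"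
    using p(1) y by (intro absolutely_continuous_on_inner) (auto simp: linear_ode_solution_def)
  ultimately have "((\<lambda>t. p t \<bullet> f t - q t \<bullet> y t) has_integral (p T \<bullet> y T - p 0 \<bullet> y 0)) {0..T}"
    using T by (intro fundamental_theorem_of_calculus_absolutely_continuous)
  moreover have "y 0 = 0" "p T = m"
    using y r by (simp_all add: linear_ode_solution_def p_def)
  ultimately show ?thesis by (simp add: p_def)
qed

section \<open>The space \<open>L\<^sup>2\<close>\<close>

lemma L2_measurable: "u \<in> L2 T \<Longrightarrow> u \<in> borel_measurable (lebesgue_on {0..T})"
  by (simp add: L2_def)

lemma L2_bounded_by:
  assumes "integrable (lebesgue_on {0..T}) g" "u \<in> borel_measurable (lebesgue_on {0..T})"
    and "AE t in lebesgue_on {0..T}. (norm (u t))\<^sup>2 \<le> g t"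
  shows "u \<in> L2 T"
  unfolding L2_def
proof (intro CollectI conjI assms)
  note [measurable] = assms(2)
  show "integrable (lebesgue_on {0..T}) (\<lambda>t. (norm (u t))\<^sup>2)"
    by (rule Bochner_Integration.integrable_bound[OF assms(1)])
      (measurable, use assms(3) in \<open>eventually_elim, simp\<close>)
qed

lemma L2_lincomb:
  assumes u: "u \<in> L2 T" and v: "v \<in> L2 T"
  shows "(\<lambda>t. \<alpha> *\<^sub>R u t + \<beta> *\<^sub>R v t) \<in> L2 T"
proof (rule L2_bounded_by)
  note [measurable] = u[THEN L2_measurable] v[THEN L2_measurable]
  show "integrable (lebesgue_on {0..T}) (\<lambda>t. 2 * \<alpha>\<^sup>2 * (norm (u t))\<^sup>2 + 2 * \<beta>\<^sup>2 * (norm (v t))\<^sup>2)"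
    using u v by (auto simp: L2_def)
  show "(\<lambda>t. \<alpha> *\<^sub>R u t + \<beta> *\<^sub>R v t) \<in> borel_measurable (lebesgue_on {0..T})" by measurable
  show "AE t in lebesgue_on {0..T}. (norm (\<alpha> *\<^sub>R u t + \<beta> *\<^sub>R v t))\<^sup>2 \<le> 2 * \<alpha>\<^sup>2 * (norm (u t))\<^sup>2 + 2 * \<beta>\<^sup>2 * (norm (v t))\<^sup>2"
  proof (rule AE_I2)
    fix t
    \<comment> \<open>The parallelogram identity; dropping the second square leaves the integrable
      majorant.\<close>
    have "(norm (\<alpha> *\<^sub>R u t + \<beta> *\<^sub>R v t))\<^sup>2 + (norm (\<alpha> *\<^sub>R u t - \<beta> *\<^sub>R v t))\<^sup>2
        = 2 * \<alpha>\<^sup>2 * (norm (u t))\<^sup>2 + 2 * \<beta>\<^sup>2 * (norm (v t))\<^sup>2"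
      unfolding power2_norm_eq_inner by (simp add: algebra_simps power2_eq_square inner_commute)
    then show "(norm (\<alpha> *\<^sub>R u t + \<beta> *\<^sub>R v t))\<^sup>2 \<le> 2 * \<alpha>\<^sup>2 * (norm (u t))\<^sup>2 + 2 * \<beta>\<^sup>2 * (norm (v t))\<^sup>2"
      by (metis le_add_same_cancel1 zero_le_power2)
  qed
qed

lemma L2_add: "u \<in> L2 T \<Longrightarrow> v \<in> L2 T \<Longrightarrow> (\<lambda>t. u t + v t) \<in> L2 T"
  using L2_lincomb[of u T v 1 1] by simp

lemma L2_scaleR: "u \<in> L2 T \<Longrightarrow> (\<lambda>t. c *\<^sub>R u t) \<in> L2 T"
  using L2_lincomb[of u T u c 0] by simp

lemma L2_continuous_on: "continuous_on {0..T} u \<Longrightarrow> u \<in> L2 T"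
  by (rule L2_bounded_by[of T "\<lambda>t. (norm (u t))\<^sup>2"])
    (auto intro!: continuous_imp_integrable_real continuous_intros
      intro: borel_measurable_integrable)

lemma integrable_L2_inner:
  assumes u: "u \<in> L2 T" and v: "v \<in> L2 T"
  shows "integrable (lebesgue_on {0..T}) (\<lambda>t. u t \<bullet> v t)"
proof (rule Bochner_Integration.integrable_bound)
  note [measurable] = u[THEN L2_measurable] v[THEN L2_measurable]
  show "integrable (lebesgue_on {0..T}) (\<lambda>t. (norm (u t))\<^sup>2 + (norm (v t))\<^sup>2)"
    using u v by (auto simp: L2_def)
  show "(\<lambda>t. u t \<bullet> v t) \<in> borel_measurable (lebesgue_on {0..T})" by measurable
  show "AE t in lebesgue_on {0..T}. norm (u t \<bullet> v t) \<le> norm ((norm (u t))\<^sup>2 + (norm (v t))\<^sup>2)"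
  proof (rule AE_I2)
    fix t
    have "norm (u t \<bullet> v t) \<le> norm (u t) * norm (v t)" by (simp add: Cauchy_Schwarz_ineq2)
    also have "\<dots> \<le> (norm (u t))\<^sup>2 + (norm (v t))\<^sup>2"
      using sum_squares_bound[of "norm (u t)" "norm (v t)"] mult_nonneg_nonneg[OF norm_ge_zero norm_ge_zero, of "u t" "v t"]
      by (simp only: mult.assoc)
    finally show "norm (u t \<bullet> v t) \<le> norm ((norm (u t))\<^sup>2 + (norm (v t))\<^sup>2)" by simp
  qed
qed

lemma L2_inner_commute: "L2_inner T u v = L2_inner T v u"
  by (simp add: L2_inner_def inner_commute)

lemma L2_inner_lincomb_left:
  assumes "u \<in> L2 T" "v \<in> L2 T" "w \<in> L2 T"
  shows "L2_inner T (\<lambda>t. \<alpha> *\<^sub>R u t + \<beta> *\<^sub>R v t) w = \<alpha> * L2_inner T u w + \<beta> * L2_inner T v w"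
  using assms by (simp add: L2_inner_def inner_add_left integrable_L2_inner)

lemma L2_inner_lincomb_right:
  assumes "u \<in> L2 T" "v \<in> L2 T" "w \<in> L2 T"
  shows "L2_inner T w (\<lambda>t. \<alpha> *\<^sub>R u t + \<beta> *\<^sub>R v t) = \<alpha> * L2_inner T w u + \<beta> * L2_inner T w v"
  using L2_inner_lincomb_left[OF assms] by (simp add: L2_inner_commute[of T w])

lemma L2_inner_add_left:
  "u \<in> L2 T \<Longrightarrow> v \<in> L2 T \<Longrightarrow> w \<in> L2 T \<Longrightarrow> L2_inner T (\<lambda>t. u t + v t) w = L2_inner T u w + L2_inner T v w"
  using L2_inner_lincomb_left[of u T v w 1 1] by simp

lemma L2_inner_add_right:
  "u \<in> L2 T \<Longrightarrow> v \<in> L2 T \<Longrightarrow> w \<in> L2 T \<Longrightarrow> L2_inner T w (\<lambda>t. u t + v t) = L2_inner T w u + L2_inner T w v"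
  using L2_inner_lincomb_right[of u T v w 1 1] by simp

lemma L2_inner_scaleR_left: "L2_inner T (\<lambda>t. c *\<^sub>R u t) v = c * L2_inner T u v"
  by (simp add: L2_inner_def)

lemma L2_inner_scaleR_right: "L2_inner T u (\<lambda>t. c *\<^sub>R v t) = c * L2_inner T u v"
  by (simp add: L2_inner_def)

lemma L2_inner_self: "L2_inner T u u = (LINT t|lebesgue_on {0..T}. (norm (u t))\<^sup>2)"
  by (simp add: L2_inner_def power2_norm_eq_inner)

lemma L2_inner_self_nonneg: "0 \<le> L2_inner T u u"
  by (simp add: L2_inner_self Bochner_Integration.integral_nonneg)

lemma L2_norm_nonneg: "0 \<le> L2_norm T u"
  by (simp add: L2_norm_def L2_inner_self_nonneg)

lemma L2_norm_squared: "(L2_norm T u)\<^sup>2 = L2_inner T u u"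
  by (simp add: L2_norm_def L2_inner_self_nonneg)

lemma L2_inner_mono:
  assumes "u \<in> L2 T" "v \<in> L2 T" "x \<in> L2 T" "y \<in> L2 T"
    and "AE t in lebesgue_on {0..T}. u t \<bullet> v t \<le> x t \<bullet> y t"
  shows "L2_inner T u v \<le> L2_inner T x y"
  unfolding L2_inner_def using assms by (intro integral_mono_AE integrable_L2_inner)

text \<open>The squared norm of u + s v is a nonnegative polynomial in s. On functions the form is
  only semidefinite, so a v of norm 0 need not be the zero function and is treated
  separately.\<close>

lemma L2_Cauchy_Schwarz:
  assumes u: "u \<in> L2 T" and v: "v \<in> L2 T"
  shows "\<bar>L2_inner T u v\<bar> \<le> L2_norm T u * L2_norm T v"
proof -
  let ?a = "L2_inner T u u" and ?b = "L2_inner T u v" and ?c = "L2_inner T v v"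
  have q: "0 \<le> ?a + 2 * s * ?b + s\<^sup>2 * ?c" for s
  proof -
    have w: "(\<lambda>t. 1 *\<^sub>R u t + s *\<^sub>R v t) \<in> L2 T" by (intro L2_lincomb u v)
    have "0 \<le> L2_inner T (\<lambda>t. 1 *\<^sub>R u t + s *\<^sub>R v t) (\<lambda>t. 1 *\<^sub>R u t + s *\<^sub>R v t)"
      by (rule L2_inner_self_nonneg)
    also have "\<dots> = 1 * L2_inner T u (\<lambda>t. 1 *\<^sub>R u t + s *\<^sub>R v t) + s * L2_inner T v (\<lambda>t. 1 *\<^sub>R u t + s *\<^sub>R v t)"
      by (rule L2_inner_lincomb_left[OF u v w])
    also have "\<dots> = ?a + 2 * s * ?b + s\<^sup>2 * ?c"
      by (simp only: L2_inner_lincomb_right[OF u v u] L2_inner_lincomb_right[OF u v v])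
        (simp add: L2_inner_commute[of T v u] power2_eq_square algebra_simps)
    finally show ?thesis .
  qed
  have "?b\<^sup>2 \<le> ?a * ?c"
  proof (cases "?c = 0")
    case True
    have "?b = 0"
    proof (rule ccontr)
      assume "?b \<noteq> 0"
      \<comment> \<open>Without its quadratic term the polynomial is affine in s, and this s gives
        it the value -1.\<close>
      then have "2 * (- (?a + 1) / (2 * ?b)) * ?b = - (?a + 1)" by simp
      then show False
        using q[of "- (?a + 1) / (2 * ?b)"] True by simp
    qed
    with True show ?thesis by simp
  next
    case False
    then have c: "?c > 0" using L2_inner_self_nonneg[of T v] by simp
    have "0 \<le> ?a - ?b\<^sup>2 / ?c"
      using q[of "- ?b / ?c"] c by (simp add: power2_eq_square)
    then show ?thesis using c by (simp add: field_simps)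
  qed
  then have "sqrt (?b\<^sup>2) \<le> sqrt (?a * ?c)" by (rule real_sqrt_le_mono)
  then show ?thesis by (simp add: L2_norm_def real_sqrt_mult)
qed

lemma L2_norm_triangle:
  assumes u: "u \<in> L2 T" and v: "v \<in> L2 T"
  shows "L2_norm T (\<lambda>t. u t + v t) \<le> L2_norm T u + L2_norm T v"
proof (rule power2_le_imp_le)
  have w: "(\<lambda>t. u t + v t) \<in> L2 T" by (intro L2_add u v)
  have "(L2_norm T (\<lambda>t. u t + v t))\<^sup>2 = L2_inner T u u + 2 * L2_inner T u v + L2_inner T v v"
    by (simp add: L2_norm_squared L2_inner_add_left L2_inner_add_right u v w L2_inner_commute[of T v u])
  also have "\<dots> \<le> (L2_norm T u)\<^sup>2 + 2 * (L2_norm T u * L2_norm T v) + (L2_norm T v)\<^sup>2"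
    using L2_Cauchy_Schwarz[OF u v] by (simp add: L2_norm_squared)
  finally show "(L2_norm T (\<lambda>t. u t + v t))\<^sup>2 \<le> (L2_norm T u + L2_norm T v)\<^sup>2"
    by (simp add: power2_sum)
qed (simp add: L2_norm_nonneg)

lemma L2_norm_mono:
  assumes "u \<in> L2 T" "v \<in> L2 T" "AE t in lebesgue_on {0..T}. norm (u t) \<le> norm (v t)"
  shows "L2_norm T u \<le> L2_norm T v"
  unfolding L2_norm_def L2_inner_self
  using assms by (intro real_sqrt_le_mono integral_mono_AE) (auto simp: L2_def)

lemma L2_norm_scaleR: "L2_norm T (\<lambda>t. c *\<^sub>R u t) = \<bar>c\<bar> * L2_norm T u"
  by (simp add: L2_norm_def L2_inner_scaleR_left L2_inner_scaleR_right real_sqrt_mult flip: mult.assoc)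

lemma L2_norm_const:
  assumes "0 \<le> T"
  shows "L2_norm T (\<lambda>t. c) = sqrt T * norm c"
proof -
  have "measure (lebesgue_on {0..T}) {0..T} = T"
    using assms by (simp add: measure_restrict_space)
  then show ?thesis
    by (simp add: L2_norm_def L2_inner_self real_sqrt_mult)
qed

text \<open>Cauchy-Schwarz against the constant 1. The estimate is the bridge between the a priori
  bound, which measures sources in L1, and controls measured in L2.\<close>

lemma L2_imp_integrable:
  assumes T: "0 \<le> T" and u: "u \<in> L2 T"
  shows "integrable (lebesgue_on {0..T}) u"
    and "(LINT t|lebesgue_on {0..T}. norm (u t)) \<le> sqrt T * L2_norm T u"
proof -
  note [measurable] = u[THEN L2_measurable]
  have nu: "(\<lambda>t. norm (u t)) \<in> L2 T"
    using u by (auto simp: L2_def)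
  have one: "(\<lambda>t. 1::real) \<in> L2 T" by (intro L2_continuous_on continuous_on_const)
  have "integrable (lebesgue_on {0..T}) (\<lambda>t. norm (u t))"
    using integrable_L2_inner[OF one nu] by simp
  then show "integrable (lebesgue_on {0..T}) u"
    by (rule Bochner_Integration.integrable_bound) auto
  have "(LINT t|lebesgue_on {0..T}. norm (u t)) = L2_inner T (\<lambda>t. 1) (\<lambda>t. norm (u t))"
    by (simp add: L2_inner_def)
  also have "\<dots> \<le> L2_norm T (\<lambda>t. 1::real) * L2_norm T (\<lambda>t. norm (u t))"
    using L2_Cauchy_Schwarz[OF one nu] by simp
  also have "L2_norm T (\<lambda>t. norm (u t)) = L2_norm T u"
    by (simp add: L2_norm_def L2_inner_self)
  finally show "(LINT t|lebesgue_on {0..T}. norm (u t)) \<le> sqrt T * L2_norm T u"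
    using T by (simp add: L2_norm_const)
qed

lemma L2_norm_le_bound:
  assumes "0 \<le> T" "u \<in> L2 T" "\<And>t. t \<in> {0..T} \<Longrightarrow> norm (u t) \<le> c"
  shows "L2_norm T u \<le> sqrt T * \<bar>c\<bar>"
proof -
  have "L2_norm T u \<le> L2_norm T (\<lambda>t. c)"
    using assms(3) by (intro L2_norm_mono[OF assms(2)] L2_continuous_on continuous_on_const AE_I2)
      (auto intro: order_trans[OF _ abs_ge_self])
  then show ?thesis using assms(1) by (simp add: L2_norm_const)
qed

section \<open>Multiplication operators and symmetric operators on L2\<close>

lemma L2_multiplication_bounded:
  fixes A :: "real \<Rightarrow> real^'n^'m"
  assumes A: "L_infinity T A"
  obtains K where "K \<ge> 0" "\<And>u. u \<in> L2 T \<Longrightarrow> (\<lambda>t. A t *v u t) \<in> L2 T"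
    "\<And>u. u \<in> L2 T \<Longrightarrow> L2_norm T (\<lambda>t. A t *v u t) \<le> K * L2_norm T u"
proof -
  obtain K where K: "K \<ge> 1" "AE t in lebesgue_on {0..T}. norm (A t) \<le> K"
    by (rule L_infinity_AE_bound[OF A])
  have le: "AE t in lebesgue_on {0..T}. norm (A t *v u t) \<le> norm (K *\<^sub>R u t)" for u
    using K(2)
  proof eventually_elim
    case (elim t)
    then have "norm (A t) * norm (u t) \<le> K * norm (u t)" by (intro mult_right_mono) auto
    then show ?case
      using norm_matrix_vector_mult_le[of "A t" "u t"] K(1) by simp
  qed
  have mem: "(\<lambda>t. A t *v u t) \<in> L2 T" if u: "u \<in> L2 T" for u
  proof (rule L2_bounded_by)
    show "integrable (lebesgue_on {0..T}) (\<lambda>t. (norm (K *\<^sub>R u t))\<^sup>2)"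
      using L2_scaleR[OF u, of K] by (simp add: L2_def)
    show "(\<lambda>t. A t *v u t) \<in> borel_measurable (lebesgue_on {0..T})"
      using A u by (intro borel_measurable_matrix_vector_mult) (auto simp: L_infinity_def L2_def)
    show "AE t in lebesgue_on {0..T}. (norm (A t *v u t))\<^sup>2 \<le> (norm (K *\<^sub>R u t))\<^sup>2"
      using le[of u] by eventually_elim (simp add: power_mono)
  qed
  show thesis
  proof (rule that[of K])
    fix u :: "real \<Rightarrow> real^'n" assume u: "u \<in> L2 T"
    show "L2_norm T (\<lambda>t. A t *v u t) \<le> K * L2_norm T u"
      using L2_norm_mono[OF mem[OF u] L2_scaleR[OF u] le] K(1) by (simp add: L2_norm_scaleR)
  qed (use K mem in auto)
qed

lemma L2_multiplication:
  fixes A :: "real \<Rightarrow> real^'n^'m"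
  shows "L_infinity T A \<Longrightarrow> u \<in> L2 T \<Longrightarrow> (\<lambda>t. A t *v u t) \<in> L2 T"
  using L2_multiplication_bounded by blast

lemma L2_inner_transpose:
  fixes A :: "real \<Rightarrow> real^'n^'m"
  shows "L2_inner T u (\<lambda>t. A t *v v t) = L2_inner T (\<lambda>t. transpose (A t) *v u t) v"
  by (simp add: L2_inner_def inner_matrix_vector_mult_transpose)

lemma L2_inner_symmetric:
  fixes A :: "real \<Rightarrow> real^'n^'n"
  assumes A: "AE t in lebesgue_on {0..T}. transpose (A t) = A t"
    and "L_infinity T A" "u \<in> L2 T" "v \<in> L2 T"
  shows "L2_inner T u (\<lambda>t. A t *v v t) = L2_inner T v (\<lambda>t. A t *v u t)"
proof -
  have "L2_inner T (\<lambda>t. transpose (A t) *v u t) v = L2_inner T (\<lambda>t. A t *v u t) v"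
    unfolding L2_inner_def
  proof (rule integral_cong_AE)
    show "AE t in lebesgue_on {0..T}. (transpose (A t) *v u t) \<bullet> v t = (A t *v u t) \<bullet> v t"
      using A by eventually_elim simp
  qed (use assms in \<open>auto intro!: borel_measurable_integrable integrable_L2_inner L2_multiplication L_infinity_transpose
      simp del: transpose_matrix_vector\<close>)
  then show ?thesis
    using L2_inner_transpose[of T u A v] L2_inner_commute[of T v "\<lambda>t. A t *v u t"] by simp
qed

lemma L2_inner_cong_AE:
  assumes "u \<in> L2 T" "u' \<in> L2 T" "v \<in> L2 T" "L2_eq T u u'"
  shows "L2_inner T u v = L2_inner T u' v"
  unfolding L2_inner_def
proof (rule integral_cong_AE)
  show "AE t in lebesgue_on {0..T}. u t \<bullet> v t = u' t \<bullet> v t"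
    using assms(4) unfolding L2_eq_def by eventually_elim simp
qed (use assms in \<open>auto intro!: borel_measurable_integrable integrable_L2_inner\<close>)

text \<open>Testing with w = u - v shows that the integral of the squared norm of u - v is 0.
  Equations between operators are thereby reduced to equations between pairings.\<close>

lemma L2_eqI_weak:
  assumes u: "u \<in> L2 T" and v: "v \<in> L2 T"
    and eq: "\<And>w. w \<in> L2 T \<Longrightarrow> L2_inner T u w = L2_inner T v w"
  shows "L2_eq T u v"
proof -
  define w where "w = (\<lambda>t. 1 *\<^sub>R u t + (- 1) *\<^sub>R v t)"
  have w: "w \<in> L2 T" unfolding w_def by (intro L2_lincomb u v)
  have "L2_inner T w w = 1 * L2_inner T u w + (- 1) * L2_inner T v w"
    unfolding w_def[abs_def] by (rule L2_inner_lincomb_left[OF u v w[unfolded w_def]])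
  then have "(LINT t|lebesgue_on {0..T}. (norm (w t))\<^sup>2) = 0"
    using eq[OF w] by (simp add: L2_inner_self)
  then have "AE t in lebesgue_on {0..T}. (norm (w t))\<^sup>2 = 0"
    using w by (subst (asm) integral_nonneg_eq_0_iff_AE) (auto simp: L2_def)
  then show ?thesis
    unfolding L2_eq_def by eventually_elim (simp add: w_def)
qed

text \<open>Symmetry makes linearity and compatibility with a.e. equality automatic.\<close>

lemma L2_bounded_operator_self_adjointI:
  fixes F :: "(real \<Rightarrow> 'a::euclidean_space) \<Rightarrow> (real \<Rightarrow> 'a)"
  assumes mem: "\<And>u. u \<in> L2 T \<Longrightarrow> F u \<in> L2 T"
    and sym: "\<And>u v. u \<in> L2 T \<Longrightarrow> v \<in> L2 T \<Longrightarrow> L2_inner T (F u) v = L2_inner T u (F v)"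
    and bound: "\<And>u. u \<in> L2 T \<Longrightarrow> L2_norm T (F u) \<le> K * L2_norm T u"
  shows "L2_bounded_operator T F" and "L2_self_adjoint T F"
proof -
  show "L2_self_adjoint T F" using sym by (simp add: L2_self_adjoint_def)
  show "L2_bounded_operator T F"
    unfolding L2_bounded_operator_def
  proof (intro conjI ballI allI impI exI[of _ K])
    fix u v :: "real \<Rightarrow> 'a" assume uv: "u \<in> L2 T" "v \<in> L2 T"
    show "L2_eq T (F (\<lambda>t. u t + v t)) (\<lambda>t. F u t + F v t)"
      by (rule L2_eqI_weak) (simp_all add: mem L2_add L2_inner_add_left sym uv)
    assume eq: "L2_eq T u v"
    show "L2_eq T (F u) (F v)"
      using L2_inner_cong_AE[OF uv _ eq] by (intro L2_eqI_weak) (simp_all add: mem sym uv)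
  next
    fix u :: "real \<Rightarrow> 'a" and c assume u: "u \<in> L2 T"
    show "L2_eq T (F (\<lambda>t. c *\<^sub>R u t)) (\<lambda>t. c *\<^sub>R F u t)"
      by (rule L2_eqI_weak) (simp_all add: mem L2_scaleR L2_inner_scaleR_left sym u)
  qed (use mem bound in auto)
qed

text \<open>Cauchy-Schwarz combined with the norm bound; the slack between K and c permits an upper
  constant that also dominates the coercivity constant.\<close>

lemma L2_op_le_scaled_id:
  fixes F :: "(real \<Rightarrow> 'a::euclidean_space) \<Rightarrow> (real \<Rightarrow> 'a)"
  assumes mem: "\<And>u. u \<in> L2 T \<Longrightarrow> F u \<in> L2 T"
    and bound: "\<And>u. u \<in> L2 T \<Longrightarrow> L2_norm T (F u) \<le> K * L2_norm T u" and "K \<le> c"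
  shows "L2_op_le T F (scaled_id c)"
  unfolding L2_op_le_def
proof
  fix u :: "real \<Rightarrow> 'a" assume u: "u \<in> L2 T"
  have "L2_inner T u (F u) \<le> L2_norm T u * L2_norm T (F u)"
    using L2_Cauchy_Schwarz[OF u mem[OF u]] by simp
  also have "\<dots> \<le> L2_norm T u * (c * L2_norm T u)"
    using bound[OF u] mult_right_mono[OF \<open>K \<le> c\<close> L2_norm_nonneg[of T u]]
    by (intro mult_left_mono L2_norm_nonneg) simp
  also have "\<dots> = c * L2_inner T u u"
    using L2_norm_squared[of T u] by (simp add: power2_eq_square)
  finally show "L2_inner T u (F u) \<le> L2_inner T u (scaled_id c u)"
    by (simp add: scaled_id_def L2_inner_scaleR_right)
qed

lemma L2_coerciveI: "0 < c \<Longrightarrow> L2_op_le T (scaled_id c) F \<Longrightarrow> L2_coercive T F"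
  unfolding L2_coercive_def L2_op_le_def scaled_id_def
  by (auto simp: L2_norm_squared L2_inner_scaleR_right)

lemma L2_multiplication_lower_bound:
  fixes D :: "real \<Rightarrow> real^'n^'n"
  assumes D: "L_infinity T D" and le: "AE t in lebesgue_on {0..T}. loewner_le (c *\<^sub>R mat 1) (D t)"
    and u: "u \<in> L2 T"
  shows "c * L2_inner T u u \<le> L2_inner T u (\<lambda>t. D t *v u t)"
proof -
  have "L2_inner T u (\<lambda>t. c *\<^sub>R u t) \<le> L2_inner T u (\<lambda>t. D t *v u t)"
  proof (rule L2_inner_mono)
    show "AE t in lebesgue_on {0..T}. u t \<bullet> c *\<^sub>R u t \<le> u t \<bullet> (D t *v u t)"
      using le
    proof eventually_elim
      case (elim t)
      then have "u t \<bullet> ((c *\<^sub>R mat 1 :: real^'n^'n) *v u t) \<le> u t \<bullet> (D t *v u t)"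
        by (simp only: loewner_le_def)
      then show ?case
        by (simp flip: scaleR_matrix_vector_assoc)
    qed
  qed (use u D in \<open>auto intro: L2_scaleR L2_multiplication\<close>)
  then show ?thesis by (simp add: L2_inner_scaleR_right)
qed

text \<open>By symmetry the two cross terms merge into the pairing of 2 F u with h. The remainder is
  exactly the pairing of h with F h, which the norm bound makes quadratic in h.\<close>

lemma has_L2_gradient_quadratic_form:
  fixes F :: "(real \<Rightarrow> 'a::euclidean_space) \<Rightarrow> (real \<Rightarrow> 'a)"
  assumes mem: "\<And>u. u \<in> L2 T \<Longrightarrow> F u \<in> L2 T"
    and sym: "\<And>u v. u \<in> L2 T \<Longrightarrow> v \<in> L2 T \<Longrightarrow> L2_inner T (F u) v = L2_inner T u (F v)"
    and bound: "\<And>u. u \<in> L2 T \<Longrightarrow> L2_norm T (F u) \<le> K * L2_norm T u"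
    and u: "u \<in> L2 T"
  shows "has_L2_gradient T (\<lambda>v. L2_inner T v (F v)) u (\<lambda>t. 2 *\<^sub>R F u t)"
  unfolding has_L2_gradient_def
proof (intro conjI allI impI)
  show "(\<lambda>t. 2 *\<^sub>R F u t) \<in> L2 T" by (intro L2_scaleR mem u)
  fix \<epsilon> :: real assume "\<epsilon> > 0"
  show "\<exists>\<delta>>0. \<forall>h\<in>L2 T. L2_norm T h < \<delta> \<longrightarrow>
      \<bar>L2_inner T (\<lambda>t. u t + h t) (F (\<lambda>t. u t + h t)) - L2_inner T u (F u) - L2_inner T (\<lambda>t. 2 *\<^sub>R F u t) h\<bar>
        \<le> \<epsilon> * L2_norm T h"
  proof (intro exI[of _ "\<epsilon> / (\<bar>K\<bar> + 1)"] conjI ballI impI)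
    show "0 < \<epsilon> / (\<bar>K\<bar> + 1)" using \<open>\<epsilon> > 0\<close> by (simp add: divide_pos_pos)
    fix h :: "real \<Rightarrow> 'a" assume h: "h \<in> L2 T" and small: "L2_norm T h < \<epsilon> / (\<bar>K\<bar> + 1)"
    have uh: "(\<lambda>t. u t + h t) \<in> L2 T" by (intro L2_add u h)
    have "L2_inner T (\<lambda>t. u t + h t) (F (\<lambda>t. u t + h t)) = L2_inner T (F u) (\<lambda>t. u t + h t) + L2_inner T (F h) (\<lambda>t. u t + h t)"
      by (simp add: L2_inner_add_left u h uh mem sym)
    also have "\<dots> = L2_inner T u (F u) + 2 * L2_inner T (F u) h + L2_inner T h (F h)"
      using sym[OF h u] L2_inner_commute[of T h "F u"] sym[OF u u] sym[OF h h]
      by (simp add: L2_inner_add_right u h mem)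
    finally have "L2_inner T (\<lambda>t. u t + h t) (F (\<lambda>t. u t + h t)) - L2_inner T u (F u) - L2_inner T (\<lambda>t. 2 *\<^sub>R F u t) h
        = L2_inner T h (F h)"
      by (simp add: L2_inner_scaleR_left)
    moreover have "\<bar>L2_inner T h (F h)\<bar> \<le> \<epsilon> * L2_norm T h"
    proof -
      have "L2_norm T (F h) \<le> (\<bar>K\<bar> + 1) * L2_norm T h"
        by (rule order_trans[OF bound[OF h]]) (intro mult_right_mono L2_norm_nonneg, simp)
      also have "\<dots> \<le> \<epsilon>"
        using small by (simp add: field_simps)
      finally have "L2_norm T h * L2_norm T (F h) \<le> L2_norm T h * \<epsilon>"
        by (intro mult_left_mono L2_norm_nonneg)
      then show ?thesis
        using L2_Cauchy_Schwarz[OF h mem[OF h]] by (simp add: mult.commute)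
    qed
    ultimately show "\<bar>L2_inner T (\<lambda>t. u t + h t) (F (\<lambda>t. u t + h t)) - L2_inner T u (F u) - L2_inner T (\<lambda>t. 2 *\<^sub>R F u t) h\<bar>
        \<le> \<epsilon> * L2_norm T h" by simp
  qed
qed

text \<open>
  The Riesz representative \<open>g = B\<^sup>T p\<close> of \<open>v \<mapsto> w(T)\<^sup>T M y\<^sub>v(T) + \<integral> (Q w)\<^sup>T y\<^sub>v\<close>, where \<open>p\<close> is
  the adjoint state with source \<open>Q w\<close> and end value \<open>M w(T)\<close>.
\<close>

lemma adjoint_representative:
  fixes A Q :: "real \<Rightarrow> real^'n^'n" and B :: "real \<Rightarrow> real^'m^'n" and M :: "real^'n^'n"
  assumes T: "0 \<le> T" and A: "L_infinity T A" and B: "L_infinity T B" and Q: "L_infinity T Q"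
  obtains C where "C \<ge> 0"
    "\<And>w c. continuous_on {0..T} w \<Longrightarrow> (\<And>t. t \<in> {0..T} \<Longrightarrow> norm (w t) \<le> c) \<Longrightarrow>
      \<exists>g\<in>L2 T. L2_norm T g \<le> C * c \<and>
        (\<forall>v\<in>L2 T. \<forall>y. linear_ode_solution T A (\<lambda>t. B t *v v t) 0 y \<longrightarrow>
          L2_inner T g v = (M *v w T) \<bullet> y T + L2_inner T (\<lambda>t. Q t *v w t) y)"
proof -
  have At: "L_infinity T (\<lambda>t. transpose (A (T - t)))"
    by (intro L_infinity_reflect[of T "\<lambda>t. transpose (A t)"] L_infinity_transpose A)
  have Bt: "L_infinity T (\<lambda>t. transpose (B t))" by (rule L_infinity_transpose[OF B])
  obtain C where C: "C \<ge> 0"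
    "\<And>f x0. integrable (lebesgue_on {0..T}) f \<Longrightarrow> \<exists>x. linear_ode_solution T (\<lambda>t. transpose (A (T - t))) f x0 x"
    "\<And>f x0 x t. integrable (lebesgue_on {0..T}) f \<Longrightarrow> linear_ode_solution T (\<lambda>t. transpose (A (T - t))) f x0 x \<Longrightarrow>
      t \<in> {0..T} \<Longrightarrow> norm (x t) \<le> C * (norm x0 + (LINT s|lebesgue_on {0..T}. norm (f s)))"
    by (rule linear_ode_solvable[OF T At]) blast
  obtain KQ where KQ: "KQ \<ge> 0"
    "\<And>u. u \<in> L2 T \<Longrightarrow> L2_norm T (\<lambda>t. Q t *v u t) \<le> KQ * L2_norm T u"
    by (rule L2_multiplication_bounded[OF Q]) (rule that)
  obtain KB where KB: "KB \<ge> 0"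
    "\<And>u. u \<in> L2 T \<Longrightarrow> L2_norm T (\<lambda>t. transpose (B t) *v u t) \<le> KB * L2_norm T u"
    by (rule L2_multiplication_bounded[OF Bt]) (rule that)
  show thesis
  \<comment> \<open>From the inside: the end value is at most \<open>norm M\<close> * c. The source
    has L1 norm at most T * KQ * c, with one factor sqrt T from the L2 norm of the bounded w and
    another from passing to L1. C bounds the adjoint state in the sup norm, sqrt T returns to L2,
    and KB accounts for the transpose of B.\<close>
  proof (rule that[of "KB * (sqrt T * (C * (norm M + T * KQ)))"])
    show "0 \<le> KB * (sqrt T * (C * (norm M + T * KQ)))"
      using KB(1) KQ(1) C(1) T by simp
    fix w :: "real \<Rightarrow> real^'n" and c :: real
    assume w: "continuous_on {0..T} w" and wc: "\<And>t. t \<in> {0..T} \<Longrightarrow> norm (w t) \<le> c"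
    have c: "0 \<le> c" using T by (intro order_trans[OF norm_ge_zero wc[of 0]]) simp
    define q where "q = (\<lambda>t. Q t *v w t)"
    have wL2: "w \<in> L2 T" by (rule L2_continuous_on[OF w])
    have qL2: "q \<in> L2 T" unfolding q_def by (intro L2_multiplication Q wL2)
    note q = L2_imp_integrable[OF T qL2]
    have "L2_norm T q \<le> KQ * (sqrt T * c)"
      using KQ(2)[OF wL2] mult_left_mono[OF L2_norm_le_bound[OF T wL2 wc] KQ(1)] c
      by (simp add: q_def)
    then have "sqrt T * L2_norm T q \<le> sqrt T * (KQ * (sqrt T * c))"
      using T by (intro mult_left_mono) auto
    also have "\<dots> = T * KQ * c"
      using T real_sqrt_mult_self[of T] by (metis abs_of_nonneg mult.assoc mult.left_commute)
    finally have q1: "(LINT t|lebesgue_on {0..T}. norm (q t)) \<le> T * KQ * c"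
      using q(2) by simp
    obtain r where r: "linear_ode_solution T (\<lambda>t. transpose (A (T - t))) (\<lambda>t. q (T - t)) (M *v w T) r"
      using C(2)[OF integrable_lebesgue_on_reflect(1)[OF q(1)]] by blast
    define p where "p = (\<lambda>t. r (T - t))"
    have pc: "continuous_on {0..T} p"
      using adjoint_solution_from_reversed(1)[OF T A q(1) r]
      unfolding p_def by (rule absolutely_continuous_on_imp_continuous_on)
    have pL2: "p \<in> L2 T" by (rule L2_continuous_on[OF pc])
    have pb: "norm (p t) \<le> C * (norm M + T * KQ) * c" if t: "t \<in> {0..T}" for t
    proof -
      have "norm (p t) \<le> C * (norm (M *v w T) + (LINT s|lebesgue_on {0..T}. norm (q (T - s))))"
        unfolding p_def using t by (intro C(3)[OF integrable_lebesgue_on_reflect(1)[OF q(1)] r]) auto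
      also have "(LINT s|lebesgue_on {0..T}. norm (q (T - s))) = (LINT s|lebesgue_on {0..T}. norm (q s))"
        using q(1) by (intro integrable_lebesgue_on_reflect(2)[of T "\<lambda>s. norm (q s)"]) auto
      also have "C * (norm (M *v w T) + (LINT s|lebesgue_on {0..T}. norm (q s))) \<le> C * (norm M * c + T * KQ * c)"
        using q1 norm_matrix_vector_mult_le[of M "w T"] mult_left_mono[OF wc[of T] norm_ge_zero[of M]] T
        by (intro mult_left_mono add_mono C(1)) auto
      finally show ?thesis by (simp add: algebra_simps)
    qed
    define g where "g = (\<lambda>t. transpose (B t) *v p t)"
    have gL2: "g \<in> L2 T" unfolding g_def by (intro L2_multiplication Bt pL2)
    have "L2_norm T g \<le> KB * L2_norm T p"
      unfolding g_def by (rule KB(2)[OF pL2])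
    also have "\<dots> \<le> KB * (sqrt T * \<bar>C * (norm M + T * KQ) * c\<bar>)"
      by (intro mult_left_mono L2_norm_le_bound T pL2 pb KB)
    also have "\<dots> = KB * (sqrt T * (C * (norm M + T * KQ))) * c"
      using C(1) KQ(1) T c by (simp add: abs_mult)
    finally have gb: "L2_norm T g \<le> KB * (sqrt T * (C * (norm M + T * KQ))) * c" .
    have "L2_inner T g v = (M *v w T) \<bullet> y T + L2_inner T (\<lambda>t. Q t *v w t) y"
      if v: "v \<in> L2 T" and y: "linear_ode_solution T A (\<lambda>t. B t *v v t) 0 y" for v y
    proof -
      have yL2: "y \<in> L2 T"
        using y by (intro L2_continuous_on absolutely_continuous_on_imp_continuous_on)
          (simp add: linear_ode_solution_def)
      have Bv: "(\<lambda>t. B t *v v t) \<in> L2 T" by (intro L2_multiplication B v)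
      have "(LINT t|lebesgue_on {0..T}. p t \<bullet> (B t *v v t) - q t \<bullet> y t)
          = integral {0..T} (\<lambda>t. p t \<bullet> (B t *v v t) - q t \<bullet> y t)"
        by (intro lebesgue_integral_eq_integral Bochner_Integration.integrable_diff integrable_L2_inner pL2 Bv qL2 yL2) auto
      also have "\<dots> = (M *v w T) \<bullet> y T"
        using integral_unique[OF adjoint_pairing[OF T A q(1) r y]] by (simp add: p_def)
      finally have "L2_inner T p (\<lambda>t. B t *v v t) - L2_inner T q y = (M *v w T) \<bullet> y T"
        using pL2 Bv qL2 yL2 by (simp add: L2_inner_def integrable_L2_inner)
      then show ?thesis
        using L2_inner_transpose[of T p B v] by (simp add: g_def q_def)
    qed
    with gL2 gb show "\<exists>g\<in>L2 T. L2_norm T g \<le> KB * (sqrt T * (C * (norm M + T * KQ))) * c \<and>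
        (\<forall>v\<in>L2 T. \<forall>y. linear_ode_solution T A (\<lambda>t. B t *v v t) 0 y \<longrightarrow>
          L2_inner T g v = (M *v w T) \<bullet> y T + L2_inner T (\<lambda>t. Q t *v w t) y)"
      by blast
  qed
qed

section \<open>The reduced problem\<close>

text \<open>The reduction is expressed as equality of the sets of minimisers for every \<beta>. It
  follows from the pointwise identities for cost and constraint. States are compared on [0,T] only,
  since a solution is arbitrary elsewhere.\<close>

theorem lemma4p2:
  fixes T \<rho> d :: real and x0 :: "real^'n"
    and A Q :: "real \<Rightarrow> real^'n^'n" and B :: "real \<Rightarrow> real^'m^'n"
    and R D :: "real \<Rightarrow> real^'m^'m" and M :: "real^'n^'n"
  assumes T: "T > 0" and \<rho>: "\<rho> > 0" and d: "d > 0"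
    and A: "L_infinity T A" and B: "L_infinity T B"
    and Q: "L_infinity T Q"
      "AE t in lebesgue_on {0..T}. transpose (Q t) = Q t \<and> loewner_le 0 (Q t)"
    and R: "L_infinity T R"
      "AE t in lebesgue_on {0..T}. transpose (R t) = R t \<and> loewner_le (\<rho> *\<^sub>R mat 1) (R t)"
    and D: "L_infinity T D"
      "AE t in lebesgue_on {0..T}. transpose (D t) = D t \<and> loewner_le (d *\<^sub>R mat 1) (D t)"
    and M: "transpose M = M" "loewner_le 0 M"
  shows
    \<comment> \<open>the state map is well defined and affine\<close>
    "(\<forall>u\<in>L2 T. \<exists>x. lq_trajectory T A B x0 u x \<and>
        (\<forall>y. lq_trajectory T A B x0 u y \<longrightarrow> (\<forall>t\<in>{0..T}. y t = x t))) \<and>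
     (\<forall>u\<in>L2 T. \<forall>v\<in>L2 T. \<forall>s. \<forall>t\<in>{0..T}.
        lq_state T A B x0 (\<lambda>\<tau>. (1 - s) *\<^sub>R u \<tau> + s *\<^sub>R v \<tau>) t =
          (1 - s) *\<^sub>R lq_state T A B x0 u t + s *\<^sub>R lq_state T A B x0 v t) \<and>
     (\<exists>(\<R> :: (real \<Rightarrow> real^'m) \<Rightarrow> (real \<Rightarrow> real^'m)) (\<rho>\<^sub>0 :: real \<Rightarrow> real^'m) (\<gamma>\<^sub>0 :: real)
        (r_bar :: real) (d_bar :: real).
        let f = (\<lambda>u. 1/2 * L2_inner T u (\<R> u) + L2_inner T \<rho>\<^sub>0 u + \<gamma>\<^sub>0);
            \<D> = mult_op D;
            \<C> = (\<lambda>u. L2_inner T u (\<D> u))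
        in
          L2_bounded_operator T \<R> \<and> L2_self_adjoint T \<R> \<and> \<rho>\<^sub>0 \<in> L2 T \<and>
          (\<forall>u\<in>L2 T. lq_cost T A B x0 Q R M u = f u) \<and>
          L2_bounded_operator T \<D> \<and> L2_self_adjoint T \<D> \<and>
          (\<forall>u\<in>L2 T. (LINT t|lebesgue_on {0..T}. u t \<bullet> (D t *v u t)) = \<C> u) \<and>
          (\<forall>u\<in>L2 T. has_L2_gradient T \<C> u (\<lambda>t. 2 *\<^sub>R \<D> u t)) \<and>
          (\<forall>\<beta> u. is_arg_min (lq_cost T A B x0 Q R M)
                    (\<lambda>v. v \<in> L2 T \<and> (LINT t|lebesgue_on {0..T}. v t \<bullet> (D t *v v t)) = \<beta>) u \<longleftrightarrow>
                  is_arg_min f (\<lambda>v. v \<in> L2 T \<and> \<C> v = \<beta>) u) \<and>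
          \<rho> \<le> r_bar \<and> L2_op_le T (scaled_id \<rho>) \<R> \<and> L2_op_le T \<R> (scaled_id r_bar) \<and>
          d \<le> d_bar \<and> L2_op_le T (scaled_id d) \<D> \<and> L2_op_le T \<D> (scaled_id d_bar) \<and>
          L2_coercive T \<R> \<and> L2_coercive T \<D>)"
proof -

  \<comment> \<open>Well-posedness and linearity of the state map\<close>
  have T0: "0 \<le> T" using T by simp
  obtain C where C: "C \<ge> 0"
    "\<And>f x0. integrable (lebesgue_on {0..T}) f \<Longrightarrow> \<exists>x. linear_ode_solution T A f x0 x"
    "\<And>f x0 x t. integrable (lebesgue_on {0..T}) f \<Longrightarrow> linear_ode_solution T A f x0 x \<Longrightarrow>
      t \<in> {0..T} \<Longrightarrow> norm (x t) \<le> C * (norm x0 + (LINT s|lebesgue_on {0..T}. norm (f s)))"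
    by (rule linear_ode_solvable[OF T0 A]) blast
  obtain KB where KB: "KB \<ge> 0"
    "\<And>u. u \<in> L2 T \<Longrightarrow> L2_norm T (\<lambda>t. B t *v u t) \<le> KB * L2_norm T u"
    by (rule L2_multiplication_bounded[OF B]) (rule that)
  have Bu: "integrable (lebesgue_on {0..T}) (\<lambda>t. B t *v u t)"
    "(LINT t|lebesgue_on {0..T}. norm (B t *v u t)) \<le> sqrt T * (KB * L2_norm T u)" if "u \<in> L2 T" for u
  proof -
    have L: "(\<lambda>t. B t *v u t) \<in> L2 T" by (rule L2_multiplication[OF B that])
    show "integrable (lebesgue_on {0..T}) (\<lambda>t. B t *v u t)" by (rule L2_imp_integrable(1)[OF T0 L])
    have "sqrt T * L2_norm T (\<lambda>t. B t *v u t) \<le> sqrt T * (KB * L2_norm T u)"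
      using T0 KB(2)[OF that] by (intro mult_left_mono) auto
    then show "(LINT t|lebesgue_on {0..T}. norm (B t *v u t)) \<le> sqrt T * (KB * L2_norm T u)"
      using L2_imp_integrable(2)[OF T0 L] by simp
  qed
  have traj_ex: "\<exists>x. lq_trajectory T A B \<xi> u x" if "u \<in> L2 T" for \<xi> u
    using C(2)[OF Bu(1)[OF that]] by (simp add: lq_trajectory_iff_linear_ode_solution)
  have traj_unique: "y t = x t" if "lq_trajectory T A B \<xi> u x" "lq_trajectory T A B \<xi> u y" "t \<in> {0..T}" for \<xi> u x y t
    using linear_ode_solution_unique[OF T0 A] that unfolding lq_trajectory_iff_linear_ode_solution by blast
  have state: "lq_trajectory T A B \<xi> u (lq_state T A B \<xi> u)" if "u \<in> L2 T" for \<xi> u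
    unfolding lq_state_def by (rule someI_ex[OF traj_ex[OF that]])
  \<comment> \<open>Initial values and controls are combined jointly, so one identity serves twice:
    weights 1 - s and s with the same x0 give affinity, and weights 1 and 1 with initial values x0
    and 0 give the splitting z + y_u.\<close>
  have state_lincomb: "lq_state T A B (\<alpha> *\<^sub>R \<xi> + \<beta> *\<^sub>R \<zeta>) (\<lambda>t. \<alpha> *\<^sub>R u t + \<beta> *\<^sub>R v t) t
      = \<alpha> *\<^sub>R lq_state T A B \<xi> u t + \<beta> *\<^sub>R lq_state T A B \<zeta> v t"
    if u: "u \<in> L2 T" and v: "v \<in> L2 T" and t: "t \<in> {0..T}" for \<alpha> \<beta> \<xi> \<zeta> u v t
  proof (rule traj_unique[OF _ state[OF L2_lincomb[OF u v]] t])
    show "lq_trajectory T A B (\<alpha> *\<^sub>R \<xi> + \<beta> *\<^sub>R \<zeta>) (\<lambda>t. \<alpha> *\<^sub>R u t + \<beta> *\<^sub>R v t)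
        (\<lambda>t. \<alpha> *\<^sub>R lq_state T A B \<xi> u t + \<beta> *\<^sub>R lq_state T A B \<zeta> v t)"
      using linear_ode_solution_lincomb[of T A _ \<xi> _ _ \<zeta> _ \<alpha> \<beta>] state[OF u, of \<xi>] state[OF v, of \<zeta>]
      by (simp add: lq_trajectory_iff_linear_ode_solution matrix_vector_right_distrib matrix_vector_mult_scaleR)
  qed
  have affine: "lq_state T A B x0 (\<lambda>\<tau>. (1 - s) *\<^sub>R u \<tau> + s *\<^sub>R v \<tau>) t =
      (1 - s) *\<^sub>R lq_state T A B x0 u t + s *\<^sub>R lq_state T A B x0 v t"
    if "u \<in> L2 T" "v \<in> L2 T" "t \<in> {0..T}" for u v s t
    using state_lincomb[OF that, of "1 - s" x0 s x0] by (simp flip: scaleR_left_distrib)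

  \<comment> \<open>Splitting of the state into drift and controlled part\<close>
  define y where "y = lq_state T A B 0"
  define z where "z = lq_state T A B x0 (\<lambda>t. 0)"
  have zero: "(\<lambda>t. 0) \<in> L2 T" by (intro L2_continuous_on continuous_on_const)
  have y_sol: "linear_ode_solution T A (\<lambda>t. B t *v u t) 0 (y u)" if "u \<in> L2 T" for u
    using state[OF that, of 0] by (simp add: y_def lq_trajectory_iff_linear_ode_solution)
  have split: "lq_state T A B x0 u t = z t + y u t" if "u \<in> L2 T" "t \<in> {0..T}" for u t
    using state_lincomb[OF zero that, of 1 x0 1 0] by (simp add: y_def z_def)
  have cont: "continuous_on {0..T} (lq_state T A B \<xi> u)" if "u \<in> L2 T" for \<xi> u
    using state[OF that, of \<xi>] by (simp add: lq_trajectory_def absolutely_continuous_on_imp_continuous_on)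
  have y_cont: "continuous_on {0..T} (y u)" if "u \<in> L2 T" for u
    unfolding y_def by (rule cont[OF that])
  have z_cont: "continuous_on {0..T} z" unfolding z_def by (rule cont[OF zero])
  have y_L2: "y u \<in> L2 T" if "u \<in> L2 T" for u by (rule L2_continuous_on[OF y_cont[OF that]])
  have z_L2: "z \<in> L2 T" by (rule L2_continuous_on[OF z_cont])
  have y_bound: "norm (y u t) \<le> C * (sqrt T * KB) * L2_norm T u" if u: "u \<in> L2 T" and t: "t \<in> {0..T}" for u t
  proof -
    have "norm (y u t) \<le> C * (LINT s|lebesgue_on {0..T}. norm (B s *v u s))"
      using C(3)[OF Bu(1)[OF u] y_sol[OF u] t] by simp
    also have "\<dots> \<le> C * (sqrt T * (KB * L2_norm T u))"
      by (intro mult_left_mono Bu(2) u C(1))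
    finally show ?thesis by (simp add: mult_ac)
  qed

  \<comment> \<open>Representatives of the quadratic and the linear form in the state\<close>
  obtain Cg where Cg: "Cg \<ge> 0"
    "\<And>w c. continuous_on {0..T} w \<Longrightarrow> (\<And>t. t \<in> {0..T} \<Longrightarrow> norm (w t) \<le> c) \<Longrightarrow>
      \<exists>g\<in>L2 T. L2_norm T g \<le> Cg * c \<and>
        (\<forall>v\<in>L2 T. \<forall>y. linear_ode_solution T A (\<lambda>t. B t *v v t) 0 y \<longrightarrow>
          L2_inner T g v = (M *v w T) \<bullet> y T + L2_inner T (\<lambda>t. Q t *v w t) y)"
    by (rule adjoint_representative[OF T0 A B Q(1), of M]) (rule that, assumption, blast)
  define K where "K = Cg * (C * (sqrt T * KB))"
  have "\<forall>u\<in>L2 T. \<exists>g. g \<in> L2 T \<and> L2_norm T g \<le> K * L2_norm T u \<and>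
      (\<forall>v\<in>L2 T. L2_inner T g v = (M *v y u T) \<bullet> y v T + L2_inner T (\<lambda>t. Q t *v y u t) (y v))"
  proof
    fix u :: "real \<Rightarrow> real^'m" assume u: "u \<in> L2 T"
    from Cg(2)[OF y_cont[OF u] y_bound[OF u]]
    obtain g where "g \<in> L2 T" "L2_norm T g \<le> Cg * (C * (sqrt T * KB) * L2_norm T u)"
      "\<And>v y'. v \<in> L2 T \<Longrightarrow> linear_ode_solution T A (\<lambda>t. B t *v v t) 0 y' \<Longrightarrow>
        L2_inner T g v = (M *v y u T) \<bullet> y' T + L2_inner T (\<lambda>t. Q t *v y u t) y'" by blast
    then show "\<exists>g. g \<in> L2 T \<and> L2_norm T g \<le> K * L2_norm T u \<and>
        (\<forall>v\<in>L2 T. L2_inner T g v = (M *v y u T) \<bullet> y v T + L2_inner T (\<lambda>t. Q t *v y u t) (y v))"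
      using y_sol by (intro exI[of _ g]) (simp add: K_def mult.assoc)
  qed
  \<comment> \<open>The choice is made separately for each control, with no linearity built
    in.\<close>
  from bchoice[OF this] obtain G where
    G: "\<And>u. u \<in> L2 T \<Longrightarrow> G u \<in> L2 T" "\<And>u. u \<in> L2 T \<Longrightarrow> L2_norm T (G u) \<le> K * L2_norm T u"
    "\<And>u v. u \<in> L2 T \<Longrightarrow> v \<in> L2 T \<Longrightarrow>
      L2_inner T (G u) v = (M *v y u T) \<bullet> y v T + L2_inner T (\<lambda>t. Q t *v y u t) (y v)"
    by blast
  have "bounded (z ` {0..T})"
    by (intro compact_imp_bounded compact_continuous_image z_cont) auto
  then obtain c where "\<And>t. t \<in> {0..T} \<Longrightarrow> norm (z t) \<le> c"
    unfolding bounded_iff by blast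
  from Cg(2)[OF z_cont this] obtain \<rho>\<^sub>0 where \<rho>\<^sub>0: "\<rho>\<^sub>0 \<in> L2 T"
    "\<And>v. v \<in> L2 T \<Longrightarrow> L2_inner T \<rho>\<^sub>0 v = (M *v z T) \<bullet> y v T + L2_inner T (\<lambda>t. Q t *v z t) (y v)"
    using y_sol by blast

  \<comment> \<open>Symmetry and definiteness of the coefficients\<close>
  have Qsym: "AE t in lebesgue_on {0..T}. transpose (Q t) = Q t"
    and Rsym: "AE t in lebesgue_on {0..T}. transpose (R t) = R t"
    and Dsym: "AE t in lebesgue_on {0..T}. transpose (D t) = D t"
    using Q(2) R(2) D(2) by (eventually_elim, simp)+
  \<comment> \<open>Semidefiniteness of Q is put in the form of a lower bound with constant 0, so
    that the estimate for R and D also applies to Q.\<close>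
  have Q0: "AE t in lebesgue_on {0..T}. loewner_le (0 *\<^sub>R mat 1) (Q t)"
    using Q(2) by eventually_elim simp
  have R\<rho>: "AE t in lebesgue_on {0..T}. loewner_le (\<rho> *\<^sub>R mat 1) (R t)"
    using R(2) by eventually_elim simp
  have Dd: "AE t in lebesgue_on {0..T}. loewner_le (d *\<^sub>R mat 1) (D t)"
    using D(2) by eventually_elim simp
  have Msym: "(M *v a) \<bullet> b = (M *v b) \<bullet> a" for a b
    using inner_matrix_vector_mult_transpose[of a M b] M(1) by (metis inner_commute)
  have Msym': "a \<bullet> (M *v b) = (M *v b) \<bullet> a" for a b
    by (rule inner_commute)
  have M0: "0 \<le> (M *v a) \<bullet> a" for a
    using M(2) by (simp add: loewner_le_def inner_commute)
  have Qsym': "L2_inner T (\<lambda>t. Q t *v a t) b = L2_inner T (\<lambda>t. Q t *v b t) a" if "a \<in> L2 T" "b \<in> L2 T" for a b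
    using L2_inner_symmetric[OF Qsym Q(1) that] by (simp add: L2_inner_commute)
  have Qmem: "(\<lambda>t. Q t *v a t) \<in> L2 T" if "a \<in> L2 T" for a by (rule L2_multiplication[OF Q(1) that])
  have Rmem: "(\<lambda>t. R t *v a t) \<in> L2 T" if "a \<in> L2 T" for a by (rule L2_multiplication[OF R(1) that])
  obtain KR where KR: "KR \<ge> 0"
    "\<And>u. u \<in> L2 T \<Longrightarrow> L2_norm T (\<lambda>t. R t *v u t) \<le> KR * L2_norm T u"
    by (rule L2_multiplication_bounded[OF R(1)]) (rule that)
  obtain KD where "KD \<ge> 0"
    "\<And>u. u \<in> L2 T \<Longrightarrow> L2_norm T (\<lambda>t. D t *v u t) \<le> KD * L2_norm T u"
    by (rule L2_multiplication_bounded[OF D(1)]) (rule that)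
  then have KD: "L2_norm T (mult_op D u) \<le> KD * L2_norm T u" if "u \<in> L2 T" for u
    unfolding mult_op_def using that by blast

  \<comment> \<open>The reduced operator and the reduced cost\<close>
  define \<R> where "\<R> = (\<lambda>u t. R t *v u t + G u t)"
  \<comment> \<open>This is the cost of the zero control, whose state is z.\<close>
  define \<gamma>\<^sub>0 where "\<gamma>\<^sub>0 = 1/2 * (z T \<bullet> (M *v z T)) + 1/2 * L2_inner T z (\<lambda>t. Q t *v z t)"
  have \<R>_mem: "\<R> u \<in> L2 T" if "u \<in> L2 T" for u
    unfolding \<R>_def by (intro L2_add Rmem G(1) that)
  have \<R>_inner: "L2_inner T (\<R> u) v = L2_inner T (\<lambda>t. R t *v u t) v +
      ((M *v y u T) \<bullet> y v T + L2_inner T (\<lambda>t. Q t *v y u t) (y v))" if "u \<in> L2 T" "v \<in> L2 T" for u v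
    unfolding \<R>_def using that by (simp add: L2_inner_add_left Rmem G)
  have \<R>_sym: "L2_inner T (\<R> u) v = L2_inner T u (\<R> v)" if "u \<in> L2 T" "v \<in> L2 T" for u v
  proof -
    have "L2_inner T (\<lambda>t. R t *v u t) v = L2_inner T (\<lambda>t. R t *v v t) u"
      using L2_inner_symmetric[OF Rsym R(1) that] by (simp add: L2_inner_commute)
    then have "L2_inner T (\<R> u) v = L2_inner T (\<R> v) u"
      using that Msym[of "y u T" "y v T"] Qsym'[OF y_L2 y_L2, of u v] by (simp add: \<R>_inner)
    then show ?thesis by (simp add: L2_inner_commute)
  qed
  have \<R>_bound: "L2_norm T (\<R> u) \<le> (KR + K) * L2_norm T u" if "u \<in> L2 T" for u
    using L2_norm_triangle[OF Rmem[OF that] G(1)[OF that]] KR(2)[OF that] G(2)[OF that]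
    by (simp add: \<R>_def distrib_right)
  \<comment> \<open>Here the definiteness of M and Q enters: on the diagonal the state terms are
    nonnegative and may be dropped, leaving the bound for R.\<close>
  have \<R>_lower: "L2_op_le T (scaled_id \<rho>) \<R>"
    unfolding L2_op_le_def
  proof
    fix u :: "real \<Rightarrow> real^'m" assume u: "u \<in> L2 T"
    have "\<rho> * L2_inner T u u \<le> L2_inner T (\<lambda>t. R t *v u t) u"
      using L2_multiplication_lower_bound[OF R(1) R\<rho> u] by (simp add: L2_inner_commute)
    moreover have "0 \<le> L2_inner T (\<lambda>t. Q t *v y u t) (y u)"
      using L2_multiplication_lower_bound[OF Q(1) Q0 y_L2[OF u]] by (simp add: L2_inner_commute)
    ultimately have "\<rho> * L2_inner T u u \<le> L2_inner T (\<R> u) u"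
      using M0[of "y u T"] by (simp add: \<R>_inner u)
    then show "L2_inner T u (scaled_id \<rho> u) \<le> L2_inner T u (\<R> u)"
      by (simp add: scaled_id_def L2_inner_scaleR_right L2_inner_commute)
  qed
  have cost: "lq_cost T A B x0 Q R M u = 1/2 * L2_inner T u (\<R> u) + L2_inner T \<rho>\<^sub>0 u + \<gamma>\<^sub>0" if u: "u \<in> L2 T" for u
  proof -
    define w where "w = (\<lambda>t. z t + y u t)"
    have w_L2: "w \<in> L2 T" unfolding w_def by (intro L2_add z_L2 y_L2 u)
    have "lq_cost T A B x0 Q R M u = 1/2 * (w T \<bullet> (M *v w T)) +
        1/2 * (LINT t|lebesgue_on {0..T}. w t \<bullet> (Q t *v w t) + u t \<bullet> (R t *v u t))"
    proof -
      have "(LINT t|lebesgue_on {0..T}. lq_state T A B x0 u t \<bullet> (Q t *v lq_state T A B x0 u t) + u t \<bullet> (R t *v u t))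
          = (LINT t|lebesgue_on {0..T}. w t \<bullet> (Q t *v w t) + u t \<bullet> (R t *v u t))"
        by (intro Bochner_Integration.integral_cong refl) (simp add: split[OF u] w_def)
      then show ?thesis
        using split[OF u, of T] T0 by (simp add: lq_cost_def Let_def w_def)
    qed
    also have "(LINT t|lebesgue_on {0..T}. w t \<bullet> (Q t *v w t) + u t \<bullet> (R t *v u t))
        = L2_inner T w (\<lambda>t. Q t *v w t) + L2_inner T u (\<lambda>t. R t *v u t)"
      unfolding L2_inner_def
      by (intro Bochner_Integration.integral_add integrable_L2_inner w_L2 u Qmem Rmem)
    \<comment> \<open>The mixed terms in z and y_u occur twice and coincide by the symmetry of M,
      and below of Q. The factor 2 cancels the 1/2 of the cost, so the linear term appears without a
      coefficient.\<close>
    also have "w T \<bullet> (M *v w T) = z T \<bullet> (M *v z T) + 2 * ((M *v z T) \<bullet> y u T) + (M *v y u T) \<bullet> y u T"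
      using Msym[of "z T" "y u T"]
      by (simp add: w_def matrix_vector_right_distrib inner_add_left inner_add_right Msym')
    also have "L2_inner T w (\<lambda>t. Q t *v w t) = L2_inner T z (\<lambda>t. Q t *v z t)
        + 2 * L2_inner T (\<lambda>t. Q t *v z t) (y u) + L2_inner T (\<lambda>t. Q t *v y u t) (y u)"
      unfolding w_def matrix_vector_right_distrib
      using Qsym'[OF z_L2 y_L2[OF u]]
      by (simp add: L2_inner_add_left L2_inner_add_right L2_add z_L2 y_L2 u Qmem)
        (simp add: L2_inner_commute)
    finally show ?thesis
      using \<R>_inner[OF u u] \<rho>\<^sub>0(2)[OF u]
      by (simp add: \<gamma>\<^sub>0_def L2_inner_commute[of T u] field_simps)
  qed

  \<comment> \<open>The constraint operator and the assembly of the reduced problem\<close>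
  have D_mem: "mult_op D u \<in> L2 T" if "u \<in> L2 T" for u
    unfolding mult_op_def by (rule L2_multiplication[OF D(1) that])
  have D_sym: "L2_inner T (mult_op D u) v = L2_inner T u (mult_op D v)" if "u \<in> L2 T" "v \<in> L2 T" for u v
    using L2_inner_symmetric[OF Dsym D(1) that] by (simp add: mult_op_def L2_inner_commute)
  have D_lower: "L2_op_le T (scaled_id d) (mult_op D)"
    unfolding L2_op_le_def scaled_id_def mult_op_def
    using L2_multiplication_lower_bound[OF D(1) Dd] by (simp add: L2_inner_scaleR_right)
  have C_eq: "(LINT t|lebesgue_on {0..T}. u t \<bullet> (D t *v u t)) = L2_inner T u (mult_op D u)" for u
    by (simp add: L2_inner_def mult_op_def)
  note \<R>_op = L2_bounded_operator_self_adjointI[of T \<R>, OF \<R>_mem \<R>_sym \<R>_bound]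
  note D_op = L2_bounded_operator_self_adjointI[of T "mult_op D", OF D_mem D_sym KD]
  \<comment> \<open>The maximum secures \<rho> \<le> \<open>r_bar\<close> by construction; likewise
    for \<open>d_bar\<close>.\<close>
  define r_bar where "r_bar = max \<rho> (KR + K)"
  define d_bar where "d_bar = max d KD"
  have upper: "L2_op_le T \<R> (scaled_id r_bar)" "L2_op_le T (mult_op D) (scaled_id d_bar)"
    by (rule L2_op_le_scaled_id[of T \<R>, OF \<R>_mem \<R>_bound], simp_all add: r_bar_def)
      (rule L2_op_le_scaled_id[of T "mult_op D", OF D_mem KD], simp_all add: d_bar_def)
  have argmin: "is_arg_min (lq_cost T A B x0 Q R M)
        (\<lambda>v. v \<in> L2 T \<and> (LINT t|lebesgue_on {0..T}. v t \<bullet> (D t *v v t)) = \<beta>) u \<longleftrightarrow>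
      is_arg_min (\<lambda>u. 1/2 * L2_inner T u (\<R> u) + L2_inner T \<rho>\<^sub>0 u + \<gamma>\<^sub>0)
        (\<lambda>v. v \<in> L2 T \<and> L2_inner T v (mult_op D v) = \<beta>) u" for \<beta> u
    unfolding is_arg_min_def C_eq using cost by (auto simp: not_less)
  have traj: "\<exists>x. lq_trajectory T A B x0 u x \<and> (\<forall>y. lq_trajectory T A B x0 u y \<longrightarrow> (\<forall>t\<in>{0..T}. y t = x t))"
    if "u \<in> L2 T" for u
    using state[OF that, of x0] traj_unique by blast
  have bars: "\<rho> \<le> r_bar" "d \<le> d_bar" by (simp_all add: r_bar_def d_bar_def)
  note gradient = has_L2_gradient_quadratic_form[of T "mult_op D", OF D_mem D_sym KD]
  show ?thesis
    unfolding Let_def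
  proof (rule conjI, use traj in blast, rule conjI, use affine in blast,
      rule exI[of _ \<R>], rule exI[of _ \<rho>\<^sub>0], rule exI[of _ \<gamma>\<^sub>0], rule exI[of _ r_bar], rule exI[of _ d_bar])
  qed (intro conjI ballI allI \<R>_op D_op \<rho>\<^sub>0(1) cost C_eq argmin upper \<R>_lower D_lower bars gradient
      L2_coerciveI[OF \<rho> \<R>_lower] L2_coerciveI[OF d D_lower])
qed

end
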